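(* Let $m\ge 2$ be an integer and let $\omega_m$ be the $m$-th multinacci number. The Hausdorff dimension of the invariant set $\mathcal{S}_{\omega_m}$ equals its box-counting dimension and is given by $$\dim_H(\mathcal{S}_{\omega_m})=\dim_B(\mathcal{S}_{\omega_m})=\frac{\log\tau_m}{\log\omega_m},$$ where $\tau_m$ is the smaller positive root of the polynomial $3z^{m+1}-3z+1$ (which lies in $(0,1/2)$).
   Context: Let $\mathbf p_k=\frac23(\cos(2\pi k/3),\sin(2\pi k/3))\in\mathbb{R}^2$, $k=0,1,2$. For $\lambda\in(0,1)$ let $f_i(\mathbf x)=\lambda\mathbf x+(1-\lambda)\mathbf p_i$, $i=0,1,2$. The invariant set $\mathcal{S}_\lambda$ is the unique non-empty compact set with $\mathcal{S}_\lambda=\bigcup_{i=0}^2 f_i(\mathcal{S}_\lambda)$. For $m\ge2$ the multinacci number $\omega_m$ is the unique positive root of $x^m+x^{m-1}+\cdots+x=1$. $\dim_H$ and $\dim_B$ denote Hausdorff and box-counting dimension. *)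

theory Defs
  imports "HOL-Analysis.Analysis"
begin

section \<open>Hausdorff dimension\<close>

text \<open>
  The power \<open>|U|\<^sup>s\<close> of the diameter, with the usual conventions \<open>|{}|\<^sup>s = 0\<close> and \<open>|U|\<^sup>0 = 1\<close> for
  non-empty \<open>U\<close>; the case distinction is needed because \<open>0 powr 0 = 0\<close>.
\<close>

definition diam_pow :: "'a::metric_space set \<Rightarrow> real \<Rightarrow> real" where
  "diam_pow U s = (if U = {} then 0 else if s = 0 then 1 else diameter U powr s)"

text \<open>
  Boundedness is required explicitly since \<open>diameter\<close> is unspecified on unbounded sets.
  Finite covers are included, as members of the sequence may be empty.
\<close>

definition delta_cover :: "real \<Rightarrow> 'a::metric_space set \<Rightarrow> (nat \<Rightarrow> 'a set) \<Rightarrow> bool" where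
  "delta_cover \<delta> A U \<longleftrightarrow> A \<subseteq> (\<Union>i. U i) \<and> (\<forall>i. bounded (U i) \<and> diameter (U i) \<le> \<delta>)"

definition hausdorff_premeasure :: "real \<Rightarrow> real \<Rightarrow> 'a::metric_space set \<Rightarrow> ennreal" where
  "hausdorff_premeasure s \<delta> A = (INF U \<in> {U. delta_cover \<delta> A U}. \<Sum>i. ennreal (diam_pow (U i) s))"

definition hausdorff_measure :: "real \<Rightarrow> 'a::metric_space set \<Rightarrow> ennreal" where
  "hausdorff_measure s A = (SUP \<delta> \<in> {0<..}. hausdorff_premeasure s \<delta> A)"

definition hausdorff_dim :: "'a::metric_space set \<Rightarrow> ereal" where
  "hausdorff_dim A = (INF s \<in> {s. 0 \<le> s \<and> hausdorff_measure s A = 0}. ereal s)"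

section \<open>Box-counting dimension\<close>

text \<open>
  The least number of sets of diameter at most \<open>\<delta>\<close> that cover \<open>A\<close>.  As usual, this and the
  box-counting dimensions are only meaningful for non-empty totally bounded \<open>A\<close>.
\<close>

definition covering_number :: "real \<Rightarrow> 'a::metric_space set \<Rightarrow> nat" where
  "covering_number \<delta> A =
     (LEAST n. \<exists>C. finite C \<and> card C = n \<and> A \<subseteq> \<Union>C \<and> (\<forall>U\<in>C. bounded U \<and> diameter U \<le> \<delta>))"

definition lower_box_dim :: "'a::metric_space set \<Rightarrow> ereal" where
  "lower_box_dim A =
     Liminf (at_right 0) (\<lambda>\<delta>. ereal (ln (real (covering_number \<delta> A)) / - ln \<delta>))"

definition upper_box_dim :: "'a::metric_space set \<Rightarrow> ereal" where
  "upper_box_dim A =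
     Limsup (at_right 0) (\<lambda>\<delta>. ereal (ln (real (covering_number \<delta> A)) / - ln \<delta>))"

text \<open>
  The box-counting dimension exists only if the lower and the upper one agree, so it is
  rendered as a relation rather than as a total function.
\<close>

definition has_box_dim :: "'a::metric_space set \<Rightarrow> ereal \<Rightarrow> bool" where
  "has_box_dim A d \<longleftrightarrow> lower_box_dim A = d \<and> upper_box_dim A = d"

section \<open>The invariant sets and the multinacci numbers\<close>

definition vertex :: "nat \<Rightarrow> real^2" where
  "vertex k = (2/3) *\<^sub>R vector [cos (2 * pi * real k / 3), sin (2 * pi * real k / 3)]"

definition contraction :: "real \<Rightarrow> nat \<Rightarrow> real^2 \<Rightarrow> real^2" where
  "contraction r i x = r *\<^sub>R x + (1 - r) *\<^sub>R vertex i"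

text \<open>The parameter \<open>r\<close> is the contraction ratio; for \<open>0 < r < 1\<close>, existence and uniqueness are Hutchinson's theorem.\<close>

definition invariant_set :: "real \<Rightarrow> (real^2) set" where
  "invariant_set r =
     (THE S. S \<noteq> {} \<and> compact S \<and> S = (\<Union>i\<in>{0,1,2}. contraction r i ` S))"

definition multinacci :: "nat \<Rightarrow> real" where
  "multinacci m = (THE x. 0 < x \<and> (\<Sum>k=1..m. x ^ k) = 1)"

text \<open>
  For \<open>m \<ge> 2\<close> the polynomial has exactly two positive roots, so its least positive root is
  the smaller one.
\<close>

definition tau :: "nat \<Rightarrow> real" where
  "tau m = (LEAST z. 0 < z \<and> 3 * z ^ (m + 1) - 3 * z + 1 = 0)"

end

theory Submission
  imports Defs
begin

text \<open>
Write \<open>r\<close> for the multinacci number, \<open>t\<close> for the root \<open>tau m\<close>, and \<open>s = ln t / ln r\<close>, so that \<open>r powr s = t\<close>.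
For a word \<open>w\<close> of length \<open>n\<close> over the three letters the composed contraction is \<open>x \<mapsto> r\<^sup>n x + v\<close>, where
\<open>v\<close> has, up to the factor \<open>1 - r\<close>, the barycentric coordinates \<open>coord r w c = \<Sum>k r\<^sup>k [w\<^sub>k = c]\<close>.
Different words may give the same map, so everything hinges on \<open>N n = card (cells r n)\<close>, the number of
different maps.

Counting.  Since \<open>1 = r + \<dots> + r\<^sup>m\<close>, the words \<open>i j\<^sup>m\<close> and \<open>j i\<^sup>m\<close> have the same coordinates, and these
relations generate all coincidences (\<open>overlap\<close>).  Hence the parts of \<open>cells r (n + 1)\<close> whose
words begin with \<open>i\<close> and with \<open>j\<close> meet in a copy of \<open>cells r (n - m)\<close>; no three of them meet, because
\<open>r < 2/3\<close>.  Inclusion-exclusion gives \<open>N (n + 1) = 3 N n - 3 N (n - m)\<close>, whose characteristic equation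
is the one of \<open>t\<close>, and \<open>N n t\<^sup>n\<close> stays between two positive constants (\<open>cells_ge\<close>, \<open>cells_le\<close>).

Separation.  A coordinate takes values that are spaced by at least \<open>r\<^sup>n\<close> on words of length \<open>n\<close>
(\<open>coord_separated\<close>): the rescaled difference of two such values follows a finite set of states until it
is so large that it can never return to zero.  Therefore a set of diameter about \<open>r\<^sup>n\<close> meets a bounded
number of cells of level \<open>n\<close> (\<open>few_neighbours\<close>).

Dimension.  Covering the invariant set by its \<open>N n \<approx> t\<^sup>-\<^sup>n\<close> cells of diameter about \<open>r\<^sup>n\<close> bounds both
dimensions by \<open>s\<close> from above.  The lower bound is again a count of cells.  By compactness a
cover may be taken finite, with members of diameters about \<open>r powr k\<^sub>i\<close>; for large \<open>n\<close> a member accounts for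
at most a constant times \<open>N (n - k\<^sub>i)\<close> of the \<open>N n\<close> cells, and dividing by \<open>N n\<close> shows that
\<open>\<Sum>i t powr k\<^sub>i\<close>, which is about the sum of the diameters to the power \<open>s\<close>, is bounded below (\<open>gasket_lower\<close>).
Applied to covers by sets of equal size, the same bound controls the covering numbers.
\<close>

section \<open>Addresses and barycentric coordinates\<close>

fun coord :: "real \<Rightarrow> nat list \<Rightarrow> nat \<Rightarrow> real" where
  "coord r [] c = 0"
| "coord r (i # w) c = of_bool (c = i) + r * coord r w c"

definition words :: "nat \<Rightarrow> nat list set" where
  "words n = {w. set w \<subseteq> {..<3} \<and> length w = n}"

text \<open>
Each element is the coordinate vector of one of the different maps that arise from words of length
\<open>n\<close>; coinciding words are thereby identified.
\<close>

definition cells :: "real \<Rightarrow> nat \<Rightarrow> (nat \<Rightarrow> real) set" where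
  "cells r n = coord r ` words n"

lemma coord_append: "coord r (u @ v) c = coord r u c + r ^ length u * coord r v c"
  by (induction u) (auto simp: algebra_simps)

lemma finite_words: "finite (words n)"
  unfolding words_def by (rule finite_lists_length_eq) simp

lemma finite_cells: "finite (cells r n)"
  by (simp add: cells_def finite_words)

lemma words_0: "words 0 = {[]}"
  by (auto simp: words_def)

lemma words_Suc: "words (Suc n) = (\<Union>i<3. (#) i ` words n)"
proof -
  have "w \<in> words (Suc n) \<longleftrightarrow> (\<exists>i<3. \<exists>u\<in>words n. w = i # u)" for w
    by (cases w) (simp_all add: words_def)
  then show ?thesis
    by blast
qed

lemma cells_split:
  assumes "a \<in> cells r (k + n)"
  shows "\<exists>b\<in>cells r k. \<exists>d\<in>cells r n. a = (\<lambda>c. b c + r ^ k * d c)"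
proof -
  obtain w where w: "w \<in> words (k + n)" "a = coord r w"
    using assms by (auto simp: cells_def)
  have "take k w \<in> words k" "drop k w \<in> words n"
    using w(1) by (auto simp: words_def dest: in_set_takeD in_set_dropD)
  then have "coord r (take k w) \<in> cells r k" "coord r (drop k w) \<in> cells r n"
    by (simp_all add: cells_def)
  moreover have "length (take k w) = k"
    using w(1) by (simp add: words_def)
  then have "a = (\<lambda>c. coord r (take k w) c + r ^ k * coord r (drop k w) c)"
    using coord_append[of r "take k w" "drop k w"] unfolding w(2) append_take_drop_id by auto
  ultimately show ?thesis
    by blast
qed

definition geo :: "real \<Rightarrow> nat \<Rightarrow> real" where
  "geo r k = (\<Sum>l<k. r ^ l)"

lemma geo_0 [simp]: "geo r 0 = 0"
  by (simp add: geo_def)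

lemma geo_Suc: "geo r (Suc k) = 1 + r * geo r k"
  by (simp add: geo_def sum.lessThan_Suc_shift sum_distrib_left del: sum.lessThan_Suc)

lemma coord_replicate: "coord r (replicate k i) c = of_bool (c = i) * geo r k"
  by (induction k) (simp_all add: geo_Suc)

lemma geo_nonneg: "0 \<le> r \<Longrightarrow> 0 \<le> geo r k"
  by (simp add: geo_def sum_nonneg)

lemma geo_Suc_ge_1: "0 \<le> r \<Longrightarrow> 1 \<le> geo r (Suc k)"
  using geo_nonneg[of r k] by (simp add: geo_Suc)

lemma geo_less: "0 < r \<Longrightarrow> r < 1 \<Longrightarrow> geo r k < 1 / (1 - r)"
  by (simp add: geo_def sum_gp_strict divide_strict_right_mono)

lemma coord_nonneg: "0 \<le> r \<Longrightarrow> 0 \<le> coord r w c"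
  by (induction w) auto

lemma coord_le_geo: "0 \<le> r \<Longrightarrow> coord r w c \<le> geo r (length w)"
proof (induction w)
  case (Cons i w)
  then have "r * coord r w c \<le> r * geo r (length w)"
    by (intro mult_left_mono) auto
  then show ?case
    by (auto simp: geo_Suc)
qed simp

lemma sum_coord:
  assumes "set w \<subseteq> {..<3}"
  shows "(\<Sum>c<3. coord r w c) = geo r (length w)"
  using assms
proof (induction w)
  case (Cons i w)
  have "(\<Sum>c<3. of_bool (c = i) :: real) = 1"
    using Cons.prems by (simp add: of_bool_def)
  then show ?case
    using Cons by (simp add: sum.distrib geo_Suc flip: sum_distrib_left)
qed simp

locale multinacci_ratio =
  fixes m :: nat and r :: real
  assumes m_ge: "2 \<le> m" and r_pos: "0 < r" and r_sum: "(\<Sum>k=1..m. r ^ k) = 1"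
begin

lemma geo_m: "r * geo r m = 1"
proof -
  have "(\<Sum>k=1..m. r ^ k) = (\<Sum>k<m. r ^ Suc k)"
    by (rule sum.reindex_bij_witness[of _ Suc "\<lambda>k. k - 1"]) auto
  then show ?thesis
    using r_sum by (simp add: geo_def sum_distrib_left)
qed

lemma r_quadratic: "r + r\<^sup>2 \<le> 1"
proof -
  have "(\<Sum>k\<in>{1,2}. r ^ k) \<le> (\<Sum>k=1..m. r ^ k)"
    using m_ge r_pos by (intro sum_mono2) auto
  then show ?thesis
    using r_sum by simp
qed

lemma r_less: "r < 2/3"
proof (rule ccontr)
  assume "\<not> r < 2/3"
  then have "(2/3)\<^sup>2 \<le> r\<^sup>2" "2/3 \<le> r"
    by (auto intro!: power_mono)
  then show False
    using r_quadratic by (simp add: power2_eq_square)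
qed

lemma r_less_1: "r < 1"
  using r_less by simp

text \<open>
A word that does not start with \<open>j\<close> has \<open>j\<close>-coordinate below \<open>r / (1 - r)\<close>, and a rescaled difference
that has grown to \<open>r / (1 - r)\<close> reaches \<open>1 / (1 - r)\<close> when divided by \<open>r\<close>.  Both uses need this bound.
\<close>

lemma geo_threshold: "2 \<le> k \<Longrightarrow> r / (1 - r) \<le> geo r k"
proof -
  assume "2 \<le> k"
  then obtain l where l: "k = Suc (Suc l)"
    by (metis add_2_eq_Suc le_Suc_ex)
  have "r * 1 \<le> r * geo r (Suc l)"
    using r_pos geo_Suc_ge_1[of r l] by (intro mult_left_mono) auto
  moreover have "r / (1 - r) \<le> 1 + r"
    using r_quadratic r_less_1 by (simp add: field_simps power2_eq_square)
  ultimately show ?thesis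
    using l by (simp add: geo_Suc)
qed

section \<open>Separation of coordinates\<close>

text \<open>
The values that the difference of two coordinates, divided by \<open>r\<^sup>n\<close>, can have: a partial geometric sum
up to sign, or a value so large that one further letter cannot bring it back below \<open>1 / (1 - r)\<close>.
\<close>

definition gap_state :: "real \<Rightarrow> bool" where
  "gap_state t \<longleftrightarrow> (\<exists>j\<le>m. \<bar>t\<bar> = geo r j) \<or> 1 / (1 - r) \<le> \<bar>t\<bar>"

text \<open>
Appending one letter to both words turns the rescaled difference \<open>t\<close> into \<open>(t + e) / r\<close>.  Up to
sign, subtraction goes from \<open>geo r (i + 1)\<close> to \<open>geo r i\<close>; a nontrivial move from 0 leads to \<open>1 / r = geo r m\<close>
in absolute value, and so does the trivial move from 1.  All other moves away from the partial sums land at or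
above \<open>1 / (1 - r)\<close>, the repelling fixed point of \<open>x \<mapsto> (x - 1) / r\<close>.
\<close>

lemma difference_step:
  assumes "gap_state t" "e \<in> {-1, 0, 1}"
  shows "gap_state ((t + e) / r)"
proof -
  have nonneg: "gap_state ((t + e) / r)"
    if t: "gap_state t" "0 \<le> t" and e: "e \<in> {-1, 0, 1}" for t e
  proof -
    have big: "gap_state x" if "1 / (1 - r) \<le> \<bar>x\<bar>" for x
      using that by (simp add: gap_state_def)
    have r1: "0 < 1 - r"
      using r_less_1 by simp
    consider j where "j \<le> m" "t = geo r j" | "1 / (1 - r) \<le> t"
      using t by (auto simp: gap_state_def)
    then show ?thesis
    proof cases
      case 1
      have inv: "1 / r = geo r m"
        using geo_m r_pos by (simp add: field_simps)
      have hit: "gap_state x" if "\<bar>x\<bar> = geo r i" "i \<le> m" for x i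
        using that by (auto simp: gap_state_def)
      consider "j = 0" | "j = 1" | "2 \<le> j"
        by linarith
      then show ?thesis
      proof cases
        case j: 1
        then show ?thesis
          using 1 e r_pos geo_nonneg[of r m] hit[of "1/r" m] hit[of "-1/r" m] hit[of 0 0] inv
          by auto
      next
        case j: 2
        have "1 / (1 - r) \<le> (1 + 1) / r"
          using r_less r_pos by (simp add: field_simps)
        then have "gap_state ((1 + 1) / r)"
          using r_pos by (intro big) auto
        then show ?thesis
          using 1 j e r_pos geo_nonneg[of r m] hit[of "1/r" m] hit[of 0 0] inv
          by (auto simp: geo_Suc)
      next
        case j: 3
        then obtain i where i: "j = Suc i"
          by (cases j) auto
        consider "e = -1" | "e = 0 \<or> e = 1"
          using e by auto
        then show ?thesis
        proof cases
          case 1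
          then show ?thesis
            using \<open>t = geo r j\<close> \<open>j \<le> m\<close> i r_pos geo_nonneg[of r i] by (intro hit[of _ i]) (auto simp: geo_Suc)
        next
          case 2
          have "r / (1 - r) \<le> t + e"
            using geo_threshold[OF j] \<open>t = geo r j\<close> 2 by auto
          then have "1 / (1 - r) \<le> (t + e) / r"
            using r_pos r1 by (simp add: field_simps)
          then show ?thesis
            by (intro big order_trans[OF _ abs_ge_self])
        qed
      qed
    next
      case 2
      have "r / (1 - r) = 1 / (1 - r) - 1"
        using r1 by (simp add: field_simps)
      then have "r / (1 - r) \<le> t + e"
        using 2 e by auto
      then have "1 / (1 - r) \<le> (t + e) / r"
        using r_pos r1 by (simp add: field_simps)
      then show ?thesis
        by (intro big order_trans[OF _ abs_ge_self])
    qed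
  qed
  show ?thesis
  proof (cases "0 \<le> t")
    case True
    then show ?thesis
      using nonneg assms by blast
  next
    case False
    then have "gap_state ((- t + - e) / r)"
      using assms by (intro nonneg) (auto simp: gap_state_def)
    moreover have "(- t + - e) / r = - ((t + e) / r)"
      by (metis minus_add_distrib minus_divide_left)
    moreover have "gap_state (- x) \<longleftrightarrow> gap_state x" for x
      by (simp add: gap_state_def)
    ultimately show ?thesis
      by (simp only:)
  qed
qed

lemma difference_states:
  "length u = length v \<Longrightarrow> gap_state ((coord r u c - coord r v c) / r ^ length v)"
proof (induction v arbitrary: u rule: rev_induct)
  case Nil
  then show ?case
    by (auto simp: gap_state_def intro!: exI[of _ 0])
next
  case (snoc j v)
  then obtain u' i where u: "u = u' @ [i]" "length u' = length v"
    by (auto simp: length_Suc_conv_rev)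
  let ?t = "(coord r u' c - coord r v c) / r ^ length v"
  let ?e = "of_bool (c = i) - of_bool (c = j) :: real"
  have "gap_state ((?t + ?e) / r)"
    using snoc.IH[OF u(2)] by (rule difference_step) auto
  moreover have "(?t + ?e) / r =
      (coord r u' c - coord r v c + r ^ length v * ?e) / (r * r ^ length v)"
    using r_pos by (simp add: add_divide_distrib)
  moreover have "coord r u c - coord r (v @ [j]) c = coord r u' c - coord r v c + r ^ length v * ?e"
    using u by (simp add: coord_append right_diff_distrib)
  ultimately show ?case
    by simp
qed

text \<open>
Apart from 0, every state is at least 1 in absolute value.
\<close>

lemma coord_separated:
  assumes "length u = length v" "coord r u c \<noteq> coord r v c"
  shows "r ^ length v \<le> \<bar>coord r u c - coord r v c\<bar>"
proof -
  let ?t = "(coord r u c - coord r v c) / r ^ length v"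
  have "1 \<le> \<bar>?t\<bar>"
    using difference_states[OF assms(1), of c] unfolding gap_state_def
  proof (elim disjE exE conjE)
    fix j assume "\<bar>?t\<bar> = geo r j"
    moreover have "?t \<noteq> 0"
      using assms(2) r_pos by simp
    ultimately show ?thesis
      using geo_Suc_ge_1[of r] r_pos by (cases j) auto
  next
    assume "1 / (1 - r) \<le> \<bar>?t\<bar>"
    moreover have "1 \<le> 1 / (1 - r)"
      using r_pos r_less_1 by (simp add: field_simps)
    ultimately show ?thesis
      by linarith
  qed
  then have "1 \<le> \<bar>coord r u c - coord r v c\<bar> / r ^ length v"
    using r_pos by simp
  then show ?thesis
    using r_pos by (simp add: pos_le_divide_eq)
qed

section \<open>Exact overlaps and the number of cells\<close>

lemma coord_less: "coord r w c < 1 / (1 - r)"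
  using coord_le_geo[of r w c] geo_less[of r "length w"] r_pos r_less_1 by simp

text \<open>
A coordinate of this size forces the first letter to be \<open>j\<close>; removing that letter lowers the
threshold from \<open>geo r (k + 1)\<close> to \<open>geo r k\<close>, so the argument repeats down to \<open>geo r 1 = 1\<close>.
\<close>

lemma starts_with_run:
  assumes "geo r (Suc k) \<le> coord r u j"
  shows "\<exists>u'. u = replicate k j @ u' \<and> 1 \<le> coord r u' j"
  using assms
proof (induction k arbitrary: u)
  case 0
  then show ?case
    by (simp add: geo_Suc)
next
  case (Suc k)
  have le: "r / (1 - r) \<le> coord r u j"
    using geo_threshold[of "Suc (Suc k)"] Suc.prems by simp
  have "0 < r / (1 - r)"
    using r_pos r_less_1 by simp
  with le obtain i v where u: "u = i # v"
    by (cases u) auto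
  have "i = j"
  proof (rule ccontr)
    assume "i \<noteq> j"
    then have "r / (1 - r) \<le> r * coord r v j"
      using le u by auto
    moreover have "r * coord r v j < r * (1 / (1 - r))"
      using coord_less r_pos by (intro mult_strict_left_mono)
    ultimately show False
      by simp
  qed
  then have "geo r (Suc k) \<le> coord r v j"
    using Suc.prems u r_pos by (simp add: geo_Suc[of r "Suc k"])
  from Suc.IH[OF this] show ?case
    using u \<open>i = j\<close> by auto
qed

text \<open>
The right-hand side is symmetric in \<open>i\<close> and \<open>j\<close>: the prefixes \<open>i j\<^sup>m\<close> and \<open>j i\<^sup>m\<close> are interchangeable.
\<close>

lemma coord_exchange: "coord r (i # replicate m j @ v) c = of_bool (c = i) + of_bool (c = j) + r ^ Suc m * coord r v c"
  using geo_m by (simp add: coord_append coord_replicate distrib_left)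

text \<open>
The hypotheses hold whenever the coordinates of \<open>w\<close> arise both from a word starting with \<open>i\<close> and from
one starting with \<open>j\<close>.  The first letter must be \<open>i\<close> or \<open>j\<close>, since three
coordinates of size at least 1 exceed the total \<open>1 / (1 - r) < 3\<close>.  After \<open>i\<close> the \<open>j\<close>-coordinate of the rest is
at least \<open>1 / r = geo r m\<close>, which forces \<open>m - 1\<close> letters \<open>j\<close>.  The remaining suffix starts with \<open>j\<close> or
satisfies the hypotheses itself, and then the induction hypothesis lets it start with \<open>j\<close> as well.
\<close>

lemma overlap:
  assumes "w \<in> words n" "i \<noteq> j" "i < 3" "j < 3" "1 \<le> coord r w i" "1 \<le> coord r w j"
  shows "\<exists>k v. n = Suc m + k \<and> v \<in> words k \<and> coord r w = coord r (i # replicate m j @ v)"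
  using assms
proof (induction n arbitrary: w i j rule: less_induct)
  case (less n)
  have *: "\<exists>k v. n = Suc m + k \<and> v \<in> words k \<and> coord r w = coord r (i # replicate m j @ v)"
    if ij: "i \<noteq> j" "i < 3" "j < 3" and w: "w = i # u" "1 \<le> coord r w j" for i j u
  proof -
    have "r * geo r m \<le> r * coord r u j"
      using geo_m w ij by auto
    then have "geo r (Suc (m - 1)) \<le> coord r u j"
      using r_pos m_ge by auto
    from starts_with_run[OF this] obtain u' where
      u': "u = replicate (m - 1) j @ u'" "1 \<le> coord r u' j"
      by blast
    then obtain c u'' where c: "u' = c # u''"
      by (cases u') auto
    have len: "n = m + length u'" and sub: "set u' \<subseteq> {..<3}"
      using less.prems(1) w u' m_ge by (auto simp: words_def)
    have run: "replicate (m - 1) j @ j # v = replicate m j @ v" for v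
    proof -
      have "replicate (m - 1) j @ j # v = replicate (Suc (m - 1)) j @ v"
        by (simp add: replicate_app_Cons_same)
      then show ?thesis
        using m_ge by simp
    qed
    show ?thesis
    proof (cases "c = j")
      case True
      have "u'' \<in> words (length u'')" "n = Suc m + length u''"
        using sub c len by (auto simp: words_def)
      moreover have "coord r w = coord r (i # replicate m j @ u'')"
        unfolding w(1) u'(1) c True run ..
      ultimately show ?thesis
        by blast
    next
      case False
      have "u' \<in> words (length u')" "length u' < n" "c < 3" "1 \<le> coord r u' c"
        using sub len m_ge c coord_nonneg[of r u'' c] r_pos by (auto simp: words_def)
      then obtain k v where v: "length u' = Suc m + k" "v \<in> words k"
          "coord r u' = coord r (j # replicate m c @ v)"
        using less.IH[of "length u'" u' j c] False ij u' by metis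
      have "coord r w x = coord r (i # replicate (m - 1) j @ j # replicate m c @ v) x" for x
        unfolding w(1) u'(1) coord.simps(2)[of r i] coord_append v(3) ..
      then have "coord r w = coord r (i # replicate m j @ replicate m c @ v)"
        unfolding run by (rule ext)
      moreover have "replicate m c @ v \<in> words (m + k)" "n = Suc m + (m + k)"
        using v \<open>c < 3\<close> len by (auto simp: words_def)
      ultimately show ?thesis
        by blast
    qed
  qed
  obtain c u where c: "w = c # u"
    using less.prems by (cases w) auto
  have "c = i \<or> c = j"
  proof (rule ccontr)
    assume n: "\<not> (c = i \<or> c = j)"
    have "c < 3"
      using less.prems(1) c by (auto simp: words_def)
    then have *: "{i, j, c} = {..<3}"
      using less.prems n by auto
    have "1 \<le> coord r w c"
      using c coord_nonneg[of r u c] r_pos by auto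
    then have "3 \<le> (\<Sum>x\<in>{i, j, c}. coord r w x)"
      using less.prems n by auto
    also have "\<dots> = geo r (length w)"
      unfolding * using less.prems by (intro sum_coord) (auto simp: words_def)
    also have "\<dots> < 1 / (1 - r)"
      using r_pos r_less_1 by (rule geo_less)
    also have "\<dots> \<le> 3"
      using r_less by (simp add: field_simps)
    finally show False
      by simp
  qed
  then show ?case
  proof
    assume "c = i"
    then show ?thesis
      using * less.prems c by blast
  next
    assume "c = j"
    then obtain k v where v: "n = Suc m + k" "v \<in> words k" "coord r w = coord r (j # replicate m i @ v)"
      using *[of j i u] less.prems c by auto
    have "coord r (j # replicate m i @ v) = coord r (i # replicate m j @ v)"
      unfolding fun_eq_iff coord_exchange by simp
    then show ?thesis
      using v by metis
  qed
qed

lemma inj_on_affine: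
  fixes q :: real and b :: "nat \<Rightarrow> real"
  assumes "q \<noteq> 0"
  shows "inj_on (\<lambda>a c. b c + q * a c) A"
proof (rule inj_onI)
  fix a a' :: "nat \<Rightarrow> real"
  assume eq: "(\<lambda>c. b c + q * a c) = (\<lambda>c. b c + q * a' c)"
  show "a = a'"
  proof
    fix c
    show "a c = a' c"
      using fun_cong[OF eq, of c] assms by simp
  qed
qed

definition branch :: "nat \<Rightarrow> nat \<Rightarrow> (nat \<Rightarrow> real) set" where
  "branch n i = (\<lambda>a c. of_bool (c = i) + r * a c) ` cells r n"

lemma branch_eq: "branch n i = (\<lambda>u. coord r (i # u)) ` words n"
proof -
  have "coord r (i # u) = (\<lambda>c. of_bool (c = i) + r * coord r u c)" for u
    by (rule ext) simp
  then show ?thesis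
    by (simp add: branch_def cells_def image_image)
qed

lemma cells_Suc: "cells r (Suc n) = branch n 0 \<union> branch n 1 \<union> branch n 2"
proof -
  have "{..<3} = {0, 1, 2::nat}"
    by auto
  then show ?thesis
    unfolding cells_def branch_eq words_Suc image_UN image_image
    by (simp add: Un_assoc del: coord.simps)
qed

lemma card_branch: "card (branch n i) = card (cells r n)"
  unfolding branch_def using r_pos
  by (simp add: card_image inj_on_affine[of r "\<lambda>c. of_bool (c = i)"])

text \<open>
Two branches overlap in a copy of a whole earlier level: this exact self-similarity of the overlaps
is what yields a linear recurrence for the number of cells.
\<close>

lemma branch_Int:
  assumes "i \<noteq> j" "i < 3" "j < 3"
  shows "branch n i \<inter> branch n j =
    (if n < m then {} else (\<lambda>a c. of_bool (c = i) + of_bool (c = j) + r ^ Suc m * a c) ` cells r (n - m))"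
    (is "_ = ?R")
proof (intro equalityI subsetI)
  fix a assume a: "a \<in> branch n i \<inter> branch n j"
  have word: "\<exists>u\<in>words n. a = coord r (h # u)" if "a \<in> branch n h" for h
    using that unfolding branch_eq by blast
  obtain u where u: "u \<in> words n" "a = coord r (i # u)"
    using a word[of i] by blast
  obtain v where v: "v \<in> words n" "a = coord r (j # v)"
    using a word[of j] by blast
  have "1 \<le> coord r (i # u) i"
    using coord_nonneg[of r u i] r_pos by simp
  moreover have "1 \<le> coord r (i # u) j"
    unfolding u(2)[symmetric] v(2) using coord_nonneg[of r v j] r_pos by simp
  moreover have "i # u \<in> words (Suc n)"
    using u assms by (auto simp: words_def)
  ultimately obtain k x where x: "Suc n = Suc m + k" "x \<in> words k"
      "coord r (i # u) = coord r (i # replicate m j @ x)"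
    using overlap[of "i # u" "Suc n" i j] assms by blast
  have "a = (\<lambda>c. of_bool (c = i) + of_bool (c = j) + r ^ Suc m * coord r x c)"
    unfolding u(2) x(3) fun_eq_iff coord_exchange by blast
  then have "a \<in> (\<lambda>v c. of_bool (c = i) + of_bool (c = j) + r ^ Suc m * coord r v c) ` words k"
    using x(2) by (rule image_eqI)
  moreover have "\<not> n < m" "n - m = k"
    using x(1) by simp_all
  ultimately show "a \<in> ?R"
    by (simp only: cells_def image_image if_False)
next
  fix a assume a: "a \<in> ?R"
  then have n: "\<not> n < m"
    by (simp split: if_splits)
  have "a \<in> (\<lambda>v c. of_bool (c = i) + of_bool (c = j) + r ^ Suc m * coord r v c) ` words (n - m)"
    using a n by (simp only: cells_def image_image if_False)
  then obtain v where v: "v \<in> words (n - m)"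
      "a = (\<lambda>c. of_bool (c = i) + of_bool (c = j) + r ^ Suc m * coord r v c)"
    by blast
  have "a = coord r (i # replicate m j @ v)" "a = coord r (j # replicate m i @ v)"
    unfolding v(2) fun_eq_iff coord_exchange by (simp_all add: add.commute)
  moreover have "replicate m j @ v \<in> words n" "replicate m i @ v \<in> words n"
    using v(1) n assms by (auto simp: words_def)
  ultimately show "a \<in> branch n i \<inter> branch n j"
    unfolding branch_eq by blast
qed

lemma card_branch_Int:
  assumes "i \<noteq> j" "i < 3" "j < 3"
  shows "card (branch n i \<inter> branch n j) = (if n < m then 0 else card (cells r (n - m)))"
proof -
  have "inj_on (\<lambda>a c. of_bool (c = i) + of_bool (c = j) + r ^ Suc m * a c) A" for A :: "(nat \<Rightarrow> real) set"
    using r_pos inj_on_affine[of "r ^ Suc m" "\<lambda>c. of_bool (c = i) + of_bool (c = j)"] by simp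
  then show ?thesis
    unfolding branch_Int[OF assms] by (simp add: card_image)
qed

lemma branch_triple: "branch n 0 \<inter> branch n 1 \<inter> branch n 2 = {}"
proof (rule ccontr)
  assume "\<not> ?thesis"
  then obtain a where a: "a \<in> branch n 0" "a \<in> branch n 1" "a \<in> branch n 2"
    by blast
  have ge: "1 \<le> a i" if "a \<in> branch n i" for i
    using that coord_nonneg[of r _ i] r_pos by (auto simp: branch_def cells_def)
  obtain w where w: "w \<in> words (Suc n)" "a = coord r w"
    using a(1) cells_Suc[of n] by (auto simp: cells_def)
  have "3 \<le> (\<Sum>c<3. a c)"
    using ge[OF a(1)] ge[OF a(2)] ge[OF a(3)] by (simp add: eval_nat_numeral)
  also have "\<dots> = geo r (length w)"
    using w by (simp add: sum_coord words_def)
  also have "\<dots> < 1 / (1 - r)"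
    using r_pos r_less_1 by (rule geo_less)
  also have "\<dots> \<le> 3"
    using r_less by (simp add: field_simps)
  finally show False
    by simp
qed

text \<open>
Inclusion-exclusion for the three branches.  The term with coefficient 3 on the left collects the
three pairwise overlaps, which are empty as long as words are too short to contain \<open>i j\<^sup>m\<close>.
\<close>

lemma card_cells_Suc:
  "card (cells r (Suc n)) + 3 * (if n < m then 0 else card (cells r (n - m))) = 3 * card (cells r n)"
proof -
  let ?B = "branch n" and ?p = "if n < m then 0 else card (cells r (n - m))"
  have fin: "finite (?B i)" for i
    by (simp add: branch_def finite_cells)
  have "card (?B 0) + card (?B 1) = card (?B 0 \<union> ?B 1) + card (?B 0 \<inter> ?B 1)"
    by (rule card_Un_Int[OF fin fin])
  moreover have "card (?B 0 \<union> ?B 1) + card (?B 2) = card (cells r (Suc n)) + card ((?B 0 \<union> ?B 1) \<inter> ?B 2)"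
    unfolding cells_Suc using fin by (intro card_Un_Int finite_UnI)
  moreover have "card ((?B 0 \<union> ?B 1) \<inter> ?B 2) = card (?B 0 \<inter> ?B 2) + card (?B 1 \<inter> ?B 2)"
    unfolding Int_Un_distrib2 using fin branch_triple[of n]
    by (intro card_Un_disjoint finite_Int disjI1) blast+
  ultimately show ?thesis
    by (simp add: card_branch card_branch_Int del: One_nat_def)
qed

end

text \<open>
The bound on \<open>m (3 t - 1)\<close> singles out the smaller positive root and keeps
\<open>scaled_count\<close> below bounded.
\<close>

locale multinacci_gasket = multinacci_ratio +
  fixes t :: real
  assumes t_pos: "0 < t" and t_root: "3 * t ^ (m + 1) - 3 * t + 1 = 0"
    and t_bound: "real m * (3 * t - 1) < 1"
begin

definition scaled_count :: "nat \<Rightarrow> real" where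
  "scaled_count n = real (card (cells r n)) * t ^ n"

lemma t_excess_pos: "0 < 3 * t - 1"
proof -
  have "3 * t - 1 = 3 * t ^ (m + 1)" using t_root by simp
  then show ?thesis using t_pos by simp
qed

lemma scaled_count_0: "scaled_count 0 = 1"
proof -
  have "cells r 0 = {coord r []}"
    by (simp add: cells_def words_0)
  then show ?thesis by (simp add: scaled_count_def)
qed

lemma scaled_count_nonneg: "0 \<le> scaled_count n"
  using t_pos by (simp add: scaled_count_def)

lemma scaled_count_early: "n < m \<Longrightarrow> scaled_count (Suc n) = 3 * t * scaled_count n"
  using card_cells_Suc[of n] by (simp add: scaled_count_def)

text \<open>
Multiplying the recurrence by \<open>t\<^sup>n\<^sup>+\<^sup>m\<^sup>+\<^sup>1\<close> and using \<open>3 t\<^sup>m\<^sup>+\<^sup>1 = 3 t - 1\<close> shows that the new increment is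
a positive multiple of the total growth over the last \<open>m\<close> steps.
\<close>

lemma scaled_count_step:
  "scaled_count (Suc (n + m)) - scaled_count (n + m) = (3 * t - 1) * (scaled_count (n + m) - scaled_count n)"
proof -
  have "real (card (cells r (Suc (n + m)))) + 3 * real (card (cells r n)) = 3 * real (card (cells r (n + m)))"
    using card_cells_Suc[of "n + m"] by simp
  then have "real (card (cells r (Suc (n + m)))) = 3 * real (card (cells r (n + m))) - 3 * real (card (cells r n))"
    by simp
  then have "scaled_count (Suc (n + m)) = 3 * t * scaled_count (n + m) - 3 * t * t ^ m * scaled_count n"
    by (simp add: scaled_count_def power_add left_diff_distrib right_diff_distrib mult_ac)
  moreover have "3 * t * t ^ m = 3 * t - 1"
    using t_root by simp
  ultimately show ?thesis
    by (simp add: left_diff_distrib right_diff_distrib)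
qed

lemma scaled_count_mono: "mono scaled_count"
proof -
  have "scaled_count n \<le> scaled_count (Suc n)" for n
  proof (induction n rule: less_induct)
    case (less n)
    show ?case
    proof (cases "n < m")
      case True
      have "1 * scaled_count n \<le> 3 * t * scaled_count n"
        using t_excess_pos scaled_count_nonneg by (intro mult_right_mono) auto
      then show ?thesis
        using scaled_count_early[OF True] by simp
    next
      case False
      then obtain k where k: "n = k + m"
        by (metis add.commute le_Suc_ex not_less)
      have "scaled_count k \<le> scaled_count i" if "k \<le> i" "i \<le> n" for i
        using that
      proof (induction i rule: dec_induct)
        case (step i)
        then show ?case
          using less[of i] by simp
      qed simp
      then have "0 \<le> (3 * t - 1) * (scaled_count n - scaled_count k)"
        using t_excess_pos k by simp
      then show ?thesis
        using scaled_count_step[of k] k by simp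
    qed
  qed
  then show ?thesis
    by (simp add: mono_iff_le_Suc)
qed

lemma cells_ge: "1 \<le> real (card (cells r n)) * t ^ n"
  using monoD[OF scaled_count_mono, of 0 n] scaled_count_0 by (simp add: scaled_count_def)

text \<open>
The increments of \<open>scaled_count (n + m)\<close> and of the weighted sum agree, so the difference is conserved.
\<close>

lemma scaled_count_invariant:
  "scaled_count (n + m) - (3 * t - 1) * (\<Sum>k<m. scaled_count (n + k)) =
   scaled_count m - (3 * t - 1) * (\<Sum>k<m. scaled_count k)"
proof (induction n)
  case (Suc n)
  have "(\<Sum>k<m. scaled_count (Suc n + k)) + scaled_count n = (\<Sum>k<Suc m. scaled_count (n + k))"
    by (simp add: sum.lessThan_Suc_shift del: sum.lessThan_Suc)
  then have "(\<Sum>k<m. scaled_count (Suc n + k)) =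
      (\<Sum>k<m. scaled_count (n + k)) + (scaled_count (n + m) - scaled_count n)"
    by simp
  then show ?case
    using Suc scaled_count_step[of n] 
    unfolding add_Suc
    by (simp only: distrib_left)
qed simp

text \<open>
By monotonicity the conserved quantity is at least \<open>(1 - m (3 t - 1)) scaled_count (n + m)\<close>, and the
factor is positive.
\<close>

lemma cells_le: "\<exists>C>0. \<forall>n. real (card (cells r n)) * t ^ n \<le> C"
proof -
  define C where "C = scaled_count m / (1 - real m * (3 * t - 1))"
  have "scaled_count n \<le> C" for n
  proof -
    have "(\<Sum>k<m. scaled_count (n + k)) \<le> (\<Sum>k<m. scaled_count (n + m))"
      by (intro sum_mono monoD[OF scaled_count_mono]) auto
    then have "(3 * t - 1) * (\<Sum>k<m. scaled_count (n + k)) \<le> (3 * t - 1) * (real m * scaled_count (n + m))"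
      using t_excess_pos by (intro mult_left_mono) auto
    moreover have "0 \<le> (3 * t - 1) * (\<Sum>k<m. scaled_count k)"
      using t_excess_pos scaled_count_nonneg by (simp add: sum_nonneg)
    ultimately have "scaled_count (n + m) * (1 - real m * (3 * t - 1)) \<le> scaled_count m"
      using scaled_count_invariant[of n] by (simp add: algebra_simps)
    then have "scaled_count (n + m) \<le> C"
      using t_bound by (simp add: C_def field_simps)
    then show ?thesis
      using monoD[OF scaled_count_mono, of n "n + m"] by simp
  qed
  moreover have "0 < C"
    using calculation[of 0] scaled_count_0 by simp
  ultimately show ?thesis
    by (auto simp: scaled_count_def)
qed

end

section \<open>A criterion for Hausdorff and box-counting dimension\<close>

lemma delta_cover_mono: "delta_cover \<delta> A U \<Longrightarrow> \<delta> \<le> \<delta>' \<Longrightarrow> delta_cover \<delta>' A U"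
  unfolding delta_cover_def by (blast intro: order_trans)

lemma le_covering_number:
  assumes "\<exists>C. finite C \<and> A \<subseteq> \<Union>C \<and> (\<forall>U\<in>C. bounded U \<and> diameter U \<le> \<delta>)"
    and "\<And>C. finite C \<Longrightarrow> A \<subseteq> \<Union>C \<Longrightarrow> (\<And>U. U \<in> C \<Longrightarrow> bounded U \<and> diameter U \<le> \<delta>) \<Longrightarrow> b \<le> real (card C)"
  shows "b \<le> real (covering_number \<delta> A)"
proof -
  have "\<exists>n C. finite C \<and> card C = n \<and> A \<subseteq> \<Union>C \<and> (\<forall>U\<in>C. bounded U \<and> diameter U \<le> \<delta>)"
    using assms(1) by simp
  from LeastI_ex[OF this] obtain C where
    C: "finite C" "card C = covering_number \<delta> A" "A \<subseteq> \<Union>C" "\<forall>U\<in>C. bounded U \<and> diameter U \<le> \<delta>"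
    unfolding covering_number_def[symmetric] by (elim exE conjE)
  have "b \<le> real (card C)"
    using C by (intro assms(2)) simp_all
  then show ?thesis
    using C(2) by simp
qed

lemma covering_number_le:
  assumes "finite C" "A \<subseteq> \<Union>C" "\<And>U. U \<in> C \<Longrightarrow> bounded U \<and> diameter U \<le> \<delta>"
  shows "covering_number \<delta> A \<le> card C"
  unfolding covering_number_def using assms by (intro Least_le) blast

text \<open>
A finite cover becomes a sequence by padding with empty sets, which contribute nothing to the sum.
\<close>

lemma delta_cover_of_finite:
  assumes "finite C" "A \<subseteq> \<Union>C" "\<And>U. U \<in> C \<Longrightarrow> bounded U \<and> diameter U \<le> \<delta>" "0 < \<delta>" "0 < s"
  shows "\<exists>U. delta_cover \<delta> A U \<and> (\<Sum>i. ennreal (diam_pow (U i) s)) \<le> ennreal (real (card C) * \<delta> powr s)"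
proof -
  obtain h where h: "bij_betw h {..<card C} C"
    using ex_bij_betw_nat_finite[OF assms(1)] by (auto simp: atLeast0LessThan)
  define U where "U i = (if i < card C then h i else {})" for i
  have U: "bounded (U i) \<and> diameter (U i) \<le> \<delta>" for i
    using bij_betwE[OF h] assms(3)[of "h i"] assms(4) by (auto simp: U_def)
  have "\<Union>C \<subseteq> (\<Union>i. U i)"
  proof
    fix x assume "x \<in> \<Union>C"
    then obtain i where "i < card C" "x \<in> h i"
      using bij_betw_imp_surj_on[OF h] by blast
    then have "x \<in> U i"
      by (simp add: U_def)
    then show "x \<in> (\<Union>i. U i)"
      by blast
  qed
  then have "delta_cover \<delta> A U"
    using assms(2) U by (auto simp: delta_cover_def)
  moreover have "(\<Sum>i. ennreal (diam_pow (U i) s)) \<le> ennreal (real (card C) * \<delta> powr s)"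
  proof -
    have "(\<Sum>i. ennreal (diam_pow (U i) s)) = (\<Sum>i<card C. ennreal (diam_pow (U i) s))"
      by (rule suminf_finite) (auto simp: U_def diam_pow_def)
    also have "\<dots> \<le> (\<Sum>i<card C. ennreal (\<delta> powr s))"
      using U assms(5) by (intro sum_mono ennreal_leI) (auto simp: diam_pow_def intro!: powr_mono2 diameter_ge_0)
    also have "\<dots> = ennreal (real (card C) * \<delta> powr s)"
      by (simp add: ennreal_mult' ennreal_of_nat_eq_real_of_nat)
    finally show ?thesis .
  qed
  ultimately show ?thesis
    by blast
qed

lemma hausdorff_measure_eq_0:
  assumes "0 < \<epsilon>" "\<And>\<delta>. 0 < \<delta> \<Longrightarrow> \<delta> < \<epsilon> \<Longrightarrow> \<exists>U. delta_cover \<delta> A U \<and> (\<Sum>i. ennreal (diam_pow (U i) s)) \<le> ennreal (g \<delta>)"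
    and "(g \<longlongrightarrow> 0) (at_right 0)"
  shows "hausdorff_measure s A = 0"
proof -
  have "hausdorff_premeasure s \<delta> A \<le> ennreal 0" if "0 < \<delta>" for \<delta>
  proof (rule tendsto_lowerbound)
    show "((\<lambda>d. ennreal (g d)) \<longlongrightarrow> ennreal 0) (at_right 0)"
      using assms(3) by (rule tendsto_ennrealI)
    have "0 < min \<delta> \<epsilon>"
      using that assms(1) by simp
    then show "\<forall>\<^sub>F d in at_right 0. hausdorff_premeasure s \<delta> A \<le> ennreal (g d)"
      unfolding eventually_at_right_field
    proof (intro exI[of _ "min \<delta> \<epsilon>"] conjI allI impI)
      fix d assume d: "0 < d" "d < min \<delta> \<epsilon>"
      then obtain U where U: "delta_cover d A U" "(\<Sum>i. ennreal (diam_pow (U i) s)) \<le> ennreal (g d)"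
        using assms(2)[of d] by auto
      from U(1) d have "delta_cover \<delta> A U"
        by (auto intro: delta_cover_mono)
      then show "hausdorff_premeasure s \<delta> A \<le> ennreal (g d)"
        unfolding hausdorff_premeasure_def using U(2) by (blast intro: INF_lower2)
    qed
  qed simp
  then show ?thesis
    unfolding hausdorff_measure_def by (intro antisym SUP_least) auto
qed

text \<open>
Both dimensions are squeezed by the same two estimates.  The upper one provides economical covers for all scales.
The lower one concerns arbitrary countable covers and is specialised to finite covers by
sets of diameter at most \<open>\<delta>\<close> in order to bound the covering number from below.
\<close>

lemma dimension_eqI:
  fixes A :: "'a::metric_space set"
  assumes s: "0 < s" and c: "0 < c" and C: "0 < C"
    and upper: "\<And>\<delta>. 0 < \<delta> \<Longrightarrow> \<delta> \<le> 1/2 \<Longrightarrow> \<exists>\<C>. finite \<C> \<and> A \<subseteq> \<Union>\<C> \<and>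
      (\<forall>U\<in>\<C>. bounded U \<and> diameter U \<le> \<delta>) \<and> real (card \<C>) * \<delta> powr s \<le> C"
    and lower: "\<And>U. delta_cover (1/2) A U \<Longrightarrow> ennreal c \<le> (\<Sum>i. ennreal (diam_pow (U i) s))"
  shows "hausdorff_dim A = ereal s" "has_box_dim A (ereal s)"
proof -
  show "hausdorff_dim A = ereal s"
    unfolding hausdorff_dim_def
  proof (rule antisym)
    show "ereal s \<le> (INF s\<in>{s. 0 \<le> s \<and> hausdorff_measure s A = 0}. ereal s)"
    proof (rule INF_greatest)
      fix t assume "t \<in> {s. 0 \<le> s \<and> hausdorff_measure s A = 0}"
      then have t: "0 \<le> t" "hausdorff_measure t A = 0"
        by auto
      show "ereal s \<le> ereal t"
      proof (rule ccontr)
        assume "\<not> ?thesis"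
        then have ts: "t < s"
          by simp
        have "ennreal c \<le> hausdorff_premeasure t (1/2) A"
          unfolding hausdorff_premeasure_def
        proof (rule INF_greatest)
          fix U assume "U \<in> {U. delta_cover (1/2) A U}"
          then have U: "delta_cover (1/2) A U"
            by simp
          have "diam_pow (U i) s \<le> diam_pow (U i) t" for i
          proof -
            have b: "bounded (U i)" "diameter (U i) \<le> 1/2"
              using U by (auto simp: delta_cover_def)
            have "diameter (U i) powr s \<le> diameter (U i) powr t"
              using ts b diameter_ge_0[OF b(1)] by (intro powr_mono') auto
            moreover have "diameter (U i) powr s \<le> 1 powr s"
              using s b diameter_ge_0[OF b(1)] by (intro powr_mono2) auto
            ultimately show ?thesis
              using s by (auto simp: diam_pow_def)
          qed
          then have "(\<Sum>i. ennreal (diam_pow (U i) s)) \<le> (\<Sum>i. ennreal (diam_pow (U i) t))"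
            by (intro suminf_le ennreal_leI) auto
          then show "ennreal c \<le> (\<Sum>i. ennreal (diam_pow (U i) t))"
            using lower[OF U] by simp
        qed
        also have "\<dots> \<le> hausdorff_measure t A"
          unfolding hausdorff_measure_def by (rule SUP_upper) simp
        finally show False
          using t(2) c by simp
      qed
    qed
    show "(INF s\<in>{s. 0 \<le> s \<and> hausdorff_measure s A = 0}. ereal s) \<le> ereal s"
    proof (rule ereal_le_epsilon2)
      fix e :: real assume e: "0 < e"
      have "hausdorff_measure (s + e) A = 0"
      proof (rule hausdorff_measure_eq_0)
        show "((\<lambda>\<delta>. C * \<delta> powr e) \<longlongrightarrow> 0) (at_right 0)"
          using e by (auto intro!: tendsto_eq_intros eventually_at_rightI[of 0 1])
        fix \<delta> :: real assume d: "0 < \<delta>" "\<delta> < 1/2"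
        then obtain \<C> where \<C>: "finite \<C>" "A \<subseteq> \<Union>\<C>" "\<And>U. U \<in> \<C> \<Longrightarrow> bounded U \<and> diameter U \<le> \<delta>"
            "real (card \<C>) * \<delta> powr s \<le> C"
          using upper[of \<delta>] by auto
        have "real (card \<C>) * \<delta> powr (s + e) \<le> C * \<delta> powr e"
          using mult_right_mono[OF \<C>(4), of "\<delta> powr e"] by (simp add: powr_add mult.assoc)
        then have "ennreal (real (card \<C>) * \<delta> powr (s + e)) \<le> ennreal (C * \<delta> powr e)"
          by (rule ennreal_leI)
        moreover obtain U where "delta_cover \<delta> A U"
            "(\<Sum>i. ennreal (diam_pow (U i) (s + e))) \<le> ennreal (real (card \<C>) * \<delta> powr (s + e))"
          using delta_cover_of_finite[OF \<C>(1,2,3) d(1), of "s + e"] s e by auto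
        ultimately show "\<exists>U. delta_cover \<delta> A U \<and> (\<Sum>i. ennreal (diam_pow (U i) (s + e))) \<le> ennreal (C * \<delta> powr e)"
          using order_trans by blast
      qed simp
      then have "(INF s\<in>{s. 0 \<le> s \<and> hausdorff_measure s A = 0}. ereal s) \<le> ereal (s + e)"
        using s e by (intro INF_lower) simp
      then show "(INF s\<in>{s. 0 \<le> s \<and> hausdorff_measure s A = 0}. ereal s) \<le> ereal s + ereal e"
        by simp
    qed
  qed
  let ?N = "\<lambda>\<delta>. real (covering_number \<delta> A)"
  let ?f = "\<lambda>\<delta>. ln (?N \<delta>) / - ln \<delta>"
  have bounds: "s + ln c / - ln \<delta> \<le> ?f \<delta> \<and> ?f \<delta> \<le> s + ln C / - ln \<delta>"
    if d: "0 < \<delta>" "\<delta> < 1/2" for \<delta>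
  proof -
    obtain \<C> where \<C>: "finite \<C>" "A \<subseteq> \<Union>\<C>" "\<And>U. U \<in> \<C> \<Longrightarrow> bounded U \<and> diameter U \<le> \<delta>"
        "real (card \<C>) * \<delta> powr s \<le> C"
      using upper[of \<delta>] d by auto
    have lo: "c / \<delta> powr s \<le> ?N \<delta>"
    proof (rule le_covering_number)
      show "\<exists>C. finite C \<and> A \<subseteq> \<Union> C \<and> (\<forall>U\<in>C. bounded U \<and> diameter U \<le> \<delta>)"
        using \<C> by blast
      fix \<D> assume "finite \<D>" "A \<subseteq> \<Union>\<D>" "\<And>U. U \<in> \<D> \<Longrightarrow> bounded U \<and> diameter U \<le> \<delta>"
      from delta_cover_of_finite[OF this d(1) s] obtain U where
        U: "delta_cover \<delta> A U" "(\<Sum>i. ennreal (diam_pow (U i) s)) \<le> ennreal (real (card \<D>) * \<delta> powr s)"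
        by blast
      have "ennreal c \<le> (\<Sum>i. ennreal (diam_pow (U i) s))"
        using d by (intro lower delta_cover_mono[OF U(1)]) simp
      also note U(2)
      finally have "c \<le> real (card \<D>) * \<delta> powr s"
        by (subst (asm) ennreal_le_iff) auto
      then show "c / \<delta> powr s \<le> real (card \<D>)"
        using d by (simp add: divide_le_eq)
    qed
    have pos: "0 < c / \<delta> powr s"
      using c d by simp
    have "?N \<delta> \<le> real (card \<C>)"
      using covering_number_le[OF \<C>(1,2,3)] by simp
    also have "\<dots> \<le> C / \<delta> powr s"
      using \<C>(4) d by (simp add: le_divide_eq)
    finally have up: "?N \<delta> \<le> C / \<delta> powr s" .
    have L: "0 < - ln \<delta>"
      using d by simp
    have ln_quot: "ln (x / \<delta> powr s) / - ln \<delta> = s + ln x / - ln \<delta>" if "0 < x" for x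
    proof -
      have "ln (x / \<delta> powr s) = ln x + s * - ln \<delta>"
        using that d by (simp add: ln_div)
      then show ?thesis
        using L by (simp add: diff_divide_distrib)
    qed
    have "ln (c / \<delta> powr s) / - ln \<delta> \<le> ?f \<delta>"
      using lo pos L by (intro divide_right_mono) auto
    moreover have "?f \<delta> \<le> ln (C / \<delta> powr s) / - ln \<delta>"
      using lo up pos L by (intro divide_right_mono ln_mono) auto
    ultimately show ?thesis
      unfolding ln_quot[OF c] ln_quot[OF C] ..
  qed
  have lim: "((\<lambda>\<delta>. s + k / - ln \<delta>) \<longlongrightarrow> s) (at_right 0)" for k :: real
  proof -
    have "filterlim (\<lambda>\<delta>::real. - ln \<delta>) at_infinity (at_right 0)"
      using ln_at_0 by (intro filterlim_at_top_imp_at_infinity) (simp add: filterlim_uminus_at_bot)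
    then have "((\<lambda>\<delta>. k / - ln \<delta>) \<longlongrightarrow> 0) (at_right 0)"
      by (rule tendsto_divide_0[OF tendsto_const])
    from tendsto_add[OF tendsto_const this, of s] show ?thesis
      by simp
  qed
  have ev: "\<forall>\<^sub>F \<delta> in at_right 0. s + ln c / - ln \<delta> \<le> ?f \<delta> \<and> ?f \<delta> \<le> s + ln C / - ln \<delta>"
    using bounds by (intro eventually_at_rightI[of 0 "1/2"]) auto
  have "(?f \<longlongrightarrow> s) (at_right 0)"
  proof (rule tendsto_sandwich)
    show "\<forall>\<^sub>F \<delta> in at_right 0. s + ln c / - ln \<delta> \<le> ?f \<delta>"
      using ev by (rule eventually_mono) blast
    show "\<forall>\<^sub>F \<delta> in at_right 0. ?f \<delta> \<le> s + ln C / - ln \<delta>"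
      using ev by (rule eventually_mono) blast
  qed (rule lim)+
  then have lim': "((\<lambda>\<delta>. ereal (?f \<delta>)) \<longlongrightarrow> ereal s) (at_right 0)"
    by (rule tendsto_ereal)
  have "lower_box_dim A = ereal s"
    unfolding lower_box_dim_def by (rule lim_imp_Liminf[OF trivial_limit_at_right_real lim'])
  moreover have "upper_box_dim A = ereal s"
    unfolding upper_box_dim_def by (rule lim_imp_Limsup[OF trivial_limit_at_right_real lim'])
  ultimately show "has_box_dim A (ereal s)"
    by (simp add: has_box_dim_def)
qed

section \<open>The invariant set and its cells\<close>

text \<open>
The factor \<open>1 - r\<close> belongs to the translation part of \<open>contraction\<close>.
\<close>

definition embed :: "real \<Rightarrow> (nat \<Rightarrow> real) \<Rightarrow> real^2" where
  "embed r a = (1 - r) *\<^sub>R (\<Sum>c<3. a c *\<^sub>R vertex c)"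

definition place :: "real \<Rightarrow> nat \<Rightarrow> (nat \<Rightarrow> real) \<Rightarrow> real^2 \<Rightarrow> real^2" where
  "place r n a x = r ^ n *\<^sub>R x + embed r a"

definition invariant :: "real \<Rightarrow> (real^2) set \<Rightarrow> bool" where
  "invariant r S \<longleftrightarrow> S \<noteq> {} \<and> compact S \<and> S = (\<Union>i\<in>{0,1,2}. contraction r i ` S)"

text \<open>
The vertices form an equilateral triangle centred at the origin.
\<close>

lemma vertex_inner:
  assumes "i < 3" "j < 3"
  shows "vertex i \<bullet> vertex j = (if i = j then 4/9 else - (2/9))"
proof -
  have cos240: "cos (2 * pi * 2 / 3) = - (1/2 :: real)"
    using cos_double_cos[of "2 * pi / 3"] by (simp add: cos_120 power2_eq_square)
  have dot: "((2/3) *\<^sub>R vector [cos a, sin a] :: real^2) \<bullet> (2/3) *\<^sub>R vector [cos b, sin b] = 4/9 * cos (a - b)" for a b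
    by (simp add: inner_vec_def sum_2 cos_diff algebra_simps)
  have "vertex i \<bullet> vertex j = 4/9 * cos (2 * pi * real i / 3 - 2 * pi * real j / 3)"
    unfolding vertex_def dot ..
  moreover have "cos (2 * pi * real i / 3 - 2 * pi * real j / 3) = (if i = j then 1 else - (1/2))"
  proof -
    have "i = 0 \<or> i = 1 \<or> i = 2" "j = 0 \<or> j = 1 \<or> j = 2"
      using assms by auto
    moreover have "cos (2 * pi / 3 - 2 * pi * 2 / 3) = - (1/2 :: real)"
      using cos_120 cos_minus[of "2 * pi / 3"] by (simp add: field_simps)
    moreover have "cos (2 * pi * 2 / 3 - 2 * pi / 3) = - (1/2 :: real)"
      using cos_120 by (simp add: field_simps)
    ultimately show ?thesis
      using cos240 cos_120 by (elim disjE) auto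
  qed
  ultimately show ?thesis
    by (cases "i = j") simp_all
qed

lemma norm_vertex: "i < 3 \<Longrightarrow> norm (vertex i) = 2/3"
proof -
  assume "i < 3"
  then have "norm (vertex i) = sqrt ((2/3)\<^sup>2)"
    by (simp add: norm_eq_sqrt_inner vertex_inner power2_eq_square)
  then show ?thesis
    by simp
qed

lemma embed_add: "embed r (\<lambda>c. a c + q * b c) = embed r a + q *\<^sub>R embed r b"
proof -
  have "(\<Sum>c<3. (a c + q * b c) *\<^sub>R vertex c) = (\<Sum>c<3. a c *\<^sub>R vertex c) + q *\<^sub>R (\<Sum>c<3. b c *\<^sub>R vertex c)"
    by (simp add: scaleR_add_left sum.distrib scaleR_sum_right)
  then show ?thesis
    by (simp add: embed_def scaleR_add_right mult.commute)
qed

lemma embed_unit: "i < 3 \<Longrightarrow> embed r (\<lambda>c. of_bool (c = i)) = (1 - r) *\<^sub>R vertex i"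
proof -
  assume "i < 3"
  then have "(\<Sum>c<3. of_bool (c = i) *\<^sub>R vertex c) = (\<Sum>c\<in>{i}. vertex c)"
    by (intro sum.mono_neutral_cong_right) auto
  then show ?thesis
    by (simp add: embed_def)
qed

text \<open>
Composing maps corresponds to concatenating words.
\<close>

lemma place_add: "place r (k + n) (\<lambda>c. b c + r ^ k * d c) x = place r k b (place r n d x)"
  by (simp add: place_def embed_add power_add scaleR_add_right)

lemma foldr_contraction:
  "set w \<subseteq> {..<3} \<Longrightarrow> foldr (contraction r) w x = place r (length w) (coord r w) x"
proof (induction w)
  case Nil
  then show ?case
    by (simp add: place_def embed_def)
next
  case (Cons i w)
  have "coord r (i # w) = (\<lambda>c. of_bool (c = i) + r * coord r w c)"
    by (rule ext) simp
  then show ?case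
    using Cons by (simp add: place_def contraction_def embed_add embed_unit scaleR_add_right)
qed

lemma invariant_iff:
  "invariant r S \<longleftrightarrow> S \<noteq> {} \<and> compact S \<and> S = (\<Union>i<3. contraction r i ` S)"
proof -
  have "{0, 1, 2} = {..<3::nat}"
    by auto
  then show ?thesis
    unfolding invariant_def by (simp only:)
qed

lemma invariant_iterate:
  assumes "invariant r S"
  shows "S = (\<Union>w\<in>words n. foldr (contraction r) w ` S)"
proof (induction n)
  case 0
  then show ?case
    by (simp add: words_0)
next
  case (Suc n)
  have "S = (\<Union>i<3. contraction r i ` S)"
    using assms unfolding invariant_iff by (elim conjE)
  also have "\<dots> = (\<Union>i<3. contraction r i ` (\<Union>w\<in>words n. foldr (contraction r) w ` S))"
    using Suc.IH by simp
  also have "\<dots> = (\<Union>w\<in>words (Suc n). foldr (contraction r) w ` S)"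
    unfolding words_Suc by (simp add: image_UN image_image) blast
  finally show ?case .
qed

lemma invariant_cells:
  assumes "invariant r S"
  shows "S = (\<Union>a\<in>cells r n. place r n a ` S)"
proof -
  have "foldr (contraction r) w ` S = place r n (coord r w) ` S" if "w \<in> words n" for w
    using that by (auto simp: foldr_contraction words_def)
  then have "(\<Union>w\<in>words n. foldr (contraction r) w ` S) = (\<Union>a\<in>cells r n. place r n a ` S)"
    by (simp add: cells_def)
  then show ?thesis
    using invariant_iterate[OF assms, of n] by simp
qed

text \<open>
A point of \<open>S\<close> has, for every \<open>n\<close>, the form \<open>place r n a z\<close>; replacing \<open>z\<close> by a point of \<open>T\<close> gives
a point of \<open>T\<close> at distance at most a constant times \<open>r\<^sup>n\<close>.
\<close>

lemma invariant_unique: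
  assumes "invariant r S" "invariant r T" "0 < r" "r < 1"
  shows "S \<subseteq> T"
proof
  fix x assume x: "x \<in> S"
  obtain y where y: "y \<in> T"
    using assms(2) by (auto simp: invariant_def)
  obtain B where B: "\<And>z. z \<in> S \<Longrightarrow> dist z y \<le> B"
    using assms(1) bounded_any_center[of S y] by (auto simp: invariant_def dist_commute compact_imp_bounded)
  have "\<exists>z\<in>T. dist z x < e" if "0 < e" for e
  proof -
    have "0 \<le> B"
      using B[OF x] zero_le_dist order_trans by blast
    then have "0 < e / (B + 1)"
      using that by simp
    then obtain n where n: "r ^ n < e / (B + 1)"
      using real_arch_pow_inv assms(4) by blast
    have "x \<in> (\<Union>a\<in>cells r n. place r n a ` S)"
      by (rule subsetD[OF equalityD1[OF invariant_cells[OF assms(1)]] x])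
    then obtain a z where a: "a \<in> cells r n" "z \<in> S" "x = place r n a z"
      by blast
    have "place r n a y \<in> (\<Union>a\<in>cells r n. place r n a ` T)"
      using a(1) y by blast
    then have "place r n a y \<in> T"
      by (rule subsetD[OF equalityD2[OF invariant_cells[OF assms(2)]]])
    moreover have "dist (place r n a y) x = r ^ n * dist z y"
      using assms(3) unfolding a(3) place_def
      by (simp add: dist_norm norm_minus_commute flip: scaleR_diff_right)
    moreover have "r ^ n * dist z y \<le> r ^ n * (B + 1)"
      using assms(3) B[OF a(2)] by (intro mult_left_mono) auto
    moreover have "r ^ n * (B + 1) < e"
      using n \<open>0 \<le> B\<close> by (simp add: pos_less_divide_eq)
    ultimately have "place r n a y \<in> T" "dist (place r n a y) x < e"
      by linarith+
    then show ?thesis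
      by blast
  qed
  then have "x \<in> closure T"
    by (simp add: closure_approachable)
  then show "x \<in> T"
    using assms(2) by (simp add: invariant_def compact_imp_closed)
qed

text \<open>
The images of \<open>vertex 0\<close> under all finite compositions form an invariant set, since \<open>vertex 0\<close> is
fixed by \<open>contraction r 0\<close>.  It is bounded, and taking closures preserves invariance because the maps are
similarities.
\<close>

lemma invariant_exists:
  assumes "0 < r" "r < 1"
  shows "\<exists>S. invariant r S"
proof -
  define P where "P = (\<lambda>w. foldr (contraction r) w (vertex 0)) ` {w. set w \<subseteq> {..<3::nat}}"
  have start: "vertex 0 \<in> P"
    unfolding P_def by (rule image_eqI[of _ _ "[]"]) auto
  have step: "P = (\<Union>i<3. contraction r i ` P)"
  proof (intro equalityI subsetI)
    fix x assume "x \<in> P"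
    then obtain w where w: "set w \<subseteq> {..<3}" "x = foldr (contraction r) w (vertex 0)"
      unfolding P_def by blast
    show "x \<in> (\<Union>i<3. contraction r i ` P)"
    proof (cases w)
      case Nil
      have "vertex 0 = contraction r 0 (vertex 0)"
        by (simp add: contraction_def flip: scaleR_add_left)
      with start have "x \<in> contraction r 0 ` P"
        using w Nil by auto
      then show ?thesis
        by force
    next
      case (Cons i u)
      have "foldr (contraction r) u (vertex 0) \<in> P"
        unfolding P_def using w(1) Cons by (intro imageI) simp
      then have "x \<in> contraction r i ` P" "i < 3"
        using w Cons by auto
      then show ?thesis
        by blast
    qed
  next
    fix x assume "x \<in> (\<Union>i<3. contraction r i ` P)"
    then obtain i w where w: "i < 3" "set w \<subseteq> {..<3}" "x = contraction r i (foldr (contraction r) w (vertex 0))"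
      unfolding P_def by blast
    then show "x \<in> P"
      unfolding P_def by (intro image_eqI[of _ _ "i # w"]) auto
  qed
  have "norm (foldr (contraction r) w (vertex 0)) \<le> 2/3" if "set w \<subseteq> {..<3}" for w
    using that
  proof (induction w)
    case (Cons i w)
    let ?y = "foldr (contraction r) w (vertex 0)"
    have "norm (contraction r i ?y) \<le> norm (r *\<^sub>R ?y) + norm ((1 - r) *\<^sub>R vertex i)"
      unfolding contraction_def by (rule norm_triangle_ineq)
    also have "\<dots> = r * norm ?y + (1 - r) * (2/3)"
      using assms Cons.prems by (simp add: norm_vertex)
    also have "\<dots> \<le> r * (2/3) + (1 - r) * (2/3)"
      using Cons assms by (intro add_right_mono mult_left_mono) auto
    also have "\<dots> = 2/3"
      by (simp add: field_simps)
    finally show ?case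
      by simp
  qed (simp add: norm_vertex)
  then have "bounded P"
    unfolding bounded_iff P_def by blast
  then have "compact (closure P)"
    by simp
  moreover have "closure P \<noteq> {}"
    using start closure_subset by fast
  moreover have "closure P = (\<Union>i<3. contraction r i ` closure P)"
  proof -
    have image: "contraction r i ` A = (+) ((1 - r) *\<^sub>R vertex i) ` (*\<^sub>R) r ` A" for i A
    proof -
      have "contraction r i = (+) ((1 - r) *\<^sub>R vertex i) \<circ> (*\<^sub>R) r"
        by (simp add: fun_eq_iff contraction_def)
      then show ?thesis
        by (simp only: image_comp)
    qed
    have closure3: "closure (\<Union>i<3. F i) = (\<Union>i<3. closure (F i))" for F :: "nat \<Rightarrow> (real^2) set"
      by (simp add: eval_nat_numeral lessThan_Suc)
    have "closure P = (\<Union>i<3. closure (contraction r i ` P))"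
      by (subst step) (rule closure3)
    also have "\<dots> = (\<Union>i<3. contraction r i ` closure P)"
      unfolding image closure_translation closure_scaleR ..
    finally show ?thesis .
  qed
  ultimately have "invariant r (closure P)"
    unfolding invariant_iff by (intro conjI)
  then show ?thesis
    by blast
qed

lemma invariant_set:
  assumes "0 < r" "r < 1"
  shows "invariant r (invariant_set r)"
proof -
  have "\<exists>!S. invariant r S"
    using invariant_exists[OF assms] invariant_unique[OF _ _ assms] by (metis antisym)
  then show ?thesis
    unfolding invariant_set_def invariant_def by (rule theI')
qed

text \<open>
Coordinates that sum to zero can be read off from inner products with the vertices: subtracting a
multiple of the total leaves only the \<open>i\<close>-th one.
\<close>

lemma embed_inner_vertex:
  assumes "(\<Sum>c<3. a c) = 0" "i < 3"
  shows "embed r a \<bullet> vertex i = (1 - r) * (2/3) * a i"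
proof -
  have "(\<Sum>c<3. a c *\<^sub>R vertex c) \<bullet> vertex i = (\<Sum>c<3. a c * (if c = i then 4/9 else - (2/9)))"
    using assms(2) by (simp add: inner_sum_left vertex_inner)
  also have "\<dots> = (\<Sum>c<3. (2/3) * (if c = i then a c else 0) - (2/9) * a c)"
    by (intro sum.cong) auto
  also have "\<dots> = (2/3) * a i"
    unfolding sum_subtractf sum_distrib_left[symmetric] using assms by simp
  finally have dot: "(\<Sum>c<3. a c *\<^sub>R vertex c) \<bullet> vertex i = (2/3) * a i" .
  show ?thesis
    by (simp only: embed_def inner_scaleR_left dot mult.assoc)
qed

lemma coord_le_norm_embed:
  assumes "(\<Sum>c<3. a c) = 0" "i < 3" "r < 1"
  shows "(1 - r) * \<bar>a i\<bar> \<le> norm (embed r a)"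
proof -
  have "\<bar>embed r a \<bullet> vertex i\<bar> \<le> norm (embed r a) * norm (vertex i)"
    by (rule Cauchy_Schwarz_ineq2)
  then have "(1 - r) * (2/3) * \<bar>a i\<bar> \<le> norm (embed r a) * (2/3)"
    using assms by (simp only: embed_inner_vertex norm_vertex abs_mult)
  then show ?thesis
    by (simp add: algebra_simps)
qed

section \<open>Few cells meet a small set\<close>

lemma abs_diff_less_of_floor_eq: "\<lfloor>x / q\<rfloor> = \<lfloor>y / q\<rfloor> \<Longrightarrow> 0 < q \<Longrightarrow> \<bar>x - y\<bar> < (q::real)"
proof -
  assume "\<lfloor>x / q\<rfloor> = \<lfloor>y / q\<rfloor>" and q: "0 < q"
  then have "\<bar>x / q - y / q\<bar> < 1"
    by linarith
  then have "\<bar>x - y\<bar> / q < 1"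
    using q by (simp flip: diff_divide_distrib)
  then show ?thesis
    using q by simp
qed

context multinacci_ratio
begin

lemma invariant_set_ratio: "invariant r (invariant_set r)"
  using r_pos r_less_1 by (rule invariant_set)

lemma sum_cells: "a \<in> cells r n \<Longrightarrow> (\<Sum>c<3. a c) = geo r n"
  by (auto simp: cells_def words_def sum_coord)

lemma cells_vanish: "a \<in> cells r n \<Longrightarrow> 3 \<le> c \<Longrightarrow> a c = 0"
proof -
  have "coord r w c = 0" if "set w \<subseteq> {..<3}" "3 \<le> c" for w
    using that by (induction w) auto
  then show "a \<in> cells r n \<Longrightarrow> 3 \<le> c \<Longrightarrow> a c = 0"
    by (auto simp: cells_def words_def)
qed

lemma cells_separated:
  assumes "a \<in> cells r n" "b \<in> cells r n" "\<bar>a c - b c\<bar> < r ^ n"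
  shows "a c = b c"
proof -
  obtain u v where "u \<in> words n" "v \<in> words n" "a = coord r u" "b = coord r v"
    using assms by (auto simp: cells_def)
  then show ?thesis
    using coord_separated[of u v c] assms(3) by (force simp: words_def)
qed

lemma cells_eqI:
  assumes "a \<in> cells r n" "b \<in> cells r n" "a 0 = b 0" "a 1 = b 1"
  shows "a = b"
proof
  fix c :: nat
  have "a 2 = b 2"
    using sum_cells[OF assms(1)] sum_cells[OF assms(2)] assms(3,4) by (simp add: eval_nat_numeral)
  moreover have "c = 0 \<or> c = 1 \<or> c = 2 \<or> 3 \<le> c"
    by auto
  ultimately show "a c = b c"
    using assms cells_vanish[OF assms(1)] cells_vanish[OF assms(2)] by auto
qed

text \<open>
Coordinates that differ have different integer parts after division by \<open>r\<^sup>n\<close>, and coordinates 0 and 1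
determine the third.  So the cells inject into a square of the integer lattice.
\<close>

lemma few_cells_in_box:
  assumes "X \<subseteq> cells r n" "\<And>a b c. a \<in> X \<Longrightarrow> b \<in> X \<Longrightarrow> c < 3 \<Longrightarrow> \<bar>a c - b c\<bar> \<le> R * r ^ n"
  shows "card X \<le> (nat (2 * \<lceil>R\<rceil> + 3)) ^ 2"
proof (cases "X = {}")
  case False
  then obtain b where b: "b \<in> X"
    by blast
  have q: "0 < r ^ n"
    using r_pos by simp
  define \<phi> where "\<phi> a = (\<lfloor>a 0 / r ^ n\<rfloor>, \<lfloor>a 1 / r ^ n\<rfloor>)" for a :: "nat \<Rightarrow> real"
  define I where "I c = {\<lfloor>b c / r ^ n\<rfloor> - \<lceil>R\<rceil> - 1 .. \<lfloor>b c / r ^ n\<rfloor> + \<lceil>R\<rceil> + 1}" for c :: nat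
  have "inj_on \<phi> X"
  proof (rule inj_onI)
    fix a a' assume a: "a \<in> X" "a' \<in> X" "\<phi> a = \<phi> a'"
    have a': "a \<in> cells r n" "a' \<in> cells r n"
      using a assms(1) by auto
    show "a = a'"
      using a(3) q by (intro cells_eqI[OF a'] cells_separated[OF a'] abs_diff_less_of_floor_eq) (auto simp: \<phi>_def)
  qed
  moreover have "\<phi> ` X \<subseteq> I 0 \<times> I 1"
  proof -
    have "\<lfloor>a c / r ^ n\<rfloor> \<in> I c" if "a \<in> X" "c < 3" for a c
    proof -
      have "\<bar>a c - b c\<bar> / r ^ n \<le> R"
        using assms(2)[OF that(1) b that(2)] q by (simp add: pos_divide_le_eq)
      then have "\<bar>a c / r ^ n - b c / r ^ n\<bar> \<le> R"
        using q by (simp flip: diff_divide_distrib)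
      then show ?thesis
        unfolding I_def atLeastAtMost_iff by linarith
    qed
    then show ?thesis
      by (auto simp: \<phi>_def)
  qed
  moreover have "finite (I 0 \<times> I 1)"
    by (simp add: I_def)
  ultimately have "card X \<le> card (I 0 \<times> I 1)"
    by (rule card_inj_on_le)
  also have "card (I c) = nat (2 * \<lceil>R\<rceil> + 3)" for c
    by (simp add: I_def)
  then have "card (I 0 \<times> I 1) = (nat (2 * \<lceil>R\<rceil> + 3)) ^ 2"
    by (simp add: card_cartesian_product power2_eq_square)
  finally show ?thesis .
qed simp

text \<open>
Cells that meet a common small set have nearby translation parts, hence nearby coordinates.
\<close>

lemma few_neighbours:
  assumes "bounded S"
  shows "\<exists>K>0. \<forall>n V. bounded V \<longrightarrow> diameter V \<le> 3 * r ^ n \<longrightarrow>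
    card {a \<in> cells r n. place r n a ` S \<inter> V \<noteq> {}} \<le> K"
proof -
  obtain B where B: "\<And>x. x \<in> S \<Longrightarrow> norm x \<le> B"
    using assms by (auto simp: bounded_iff)
  define R where "R = (3 + 2 * B) / (1 - r)"
  have box: "card {a \<in> cells r n. place r n a ` S \<inter> V \<noteq> {}} \<le> (nat (2 * \<lceil>R\<rceil> + 3)) ^ 2"
    if V: "bounded V" "diameter V \<le> 3 * r ^ n" for n V
  proof (rule few_cells_in_box)
    fix a b c
    assume a: "a \<in> {a \<in> cells r n. place r n a ` S \<inter> V \<noteq> {}}"
      and b: "b \<in> {a \<in> cells r n. place r n a ` S \<inter> V \<noteq> {}}" and c: "c < (3::nat)"
    from a obtain x where x: "x \<in> S" "place r n a x \<in> V"
      by blast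
    from b obtain y where y: "y \<in> S" "place r n b y \<in> V"
      by blast
    have e: "embed r (\<lambda>c. a c - b c) = (place r n a x - place r n b y) - r ^ n *\<^sub>R (x - y)"
      using embed_add[of r a "-1" b] by (simp add: place_def scaleR_diff_right)
    have "norm (place r n a x - place r n b y) \<le> 3 * r ^ n"
      using diameter_bounded_bound[OF V(1) x(2) y(2)] V(2) by (simp add: dist_norm)
    moreover have "norm (r ^ n *\<^sub>R (x - y)) \<le> r ^ n * (2 * B)"
      using B[OF x(1)] B[OF y(1)] norm_triangle_ineq4[of x y] r_pos by (simp add: mult_left_mono)
    ultimately have "norm (embed r (\<lambda>c. a c - b c)) \<le> 3 * r ^ n + r ^ n * (2 * B)"
      unfolding e using norm_triangle_ineq4 by (rule order_trans[OF _ add_mono, rotated])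
    moreover have "(\<Sum>c<3. a c - b c) = 0"
      using a b sum_cells[of a n] sum_cells[of b n] by (simp add: sum_subtractf)
    then have "(1 - r) * \<bar>a c - b c\<bar> \<le> norm (embed r (\<lambda>c. a c - b c))"
      using coord_le_norm_embed[of "\<lambda>c. a c - b c" c r] c r_less_1 by blast
    moreover have "(3 + 2 * B) * r ^ n = 3 * r ^ n + r ^ n * (2 * B)"
      by (simp add: distrib_right)
    ultimately have "(1 - r) * \<bar>a c - b c\<bar> \<le> (3 + 2 * B) * r ^ n"
      by linarith
    then show "\<bar>a c - b c\<bar> \<le> R * r ^ n"
      using r_less_1 by (simp add: R_def pos_le_divide_eq mult.commute)
  qed auto
  show ?thesis
    by (intro exI[of _ "Suc ((nat (2 * \<lceil>R\<rceil> + 3)) ^ 2)"] conjI allI impI le_SucI box) simp_all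
qed

lemma ex_scale:
  assumes "0 < d" "d < 1"
  shows "\<exists>k. r ^ Suc k \<le> d \<and> d < r ^ k"
proof -
  define j where "j = (LEAST j. r ^ j \<le> d)"
  obtain n where "r ^ n < d"
    using real_arch_pow_inv[OF assms(1) r_less_1] by blast
  then have j: "r ^ j \<le> d"
    unfolding j_def by (intro LeastI[of "\<lambda>j. r ^ j \<le> d" n]) simp
  have "j \<noteq> 0"
    using j assms by (intro notI) simp
  then obtain k where k: "j = Suc k"
    by (cases j) auto
  have "\<not> r ^ k \<le> d"
    using not_less_Least[of k "\<lambda>j. r ^ j \<le> d"] k by (simp add: j_def)
  then show ?thesis
    using j k by auto
qed

end

section \<open>The dimension of the gasket\<close>

context multinacci_gasket
begin

definition gasket_dim :: real where
  "gasket_dim = ln t / ln r"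

lemma t_less_1: "t < 1"
proof (rule ccontr)
  assume "\<not> t < 1"
  then have "t ^ 1 \<le> t ^ (m + 1)"
    by (intro power_increasing) auto
  then show False
    using t_root by simp
qed

lemma gasket_dim_pos: "0 < gasket_dim"
  using t_pos t_less_1 r_pos r_less_1 by (simp add: gasket_dim_def divide_neg_neg)

lemma power_powr_gasket_dim: "(r ^ n) powr gasket_dim = t ^ n"
proof -
  have "ln r \<noteq> 0"
    using r_pos r_less_1 by simp
  then have "(r ^ n) powr gasket_dim = exp (real n * ln t)"
    using r_pos by (simp add: powr_def gasket_dim_def ln_realpow)
  also have "\<dots> = t ^ n"
    using t_pos by (simp add: exp_of_nat_mult)
  finally show ?thesis .
qed

text \<open>
The cells of level \<open>k + 1\<close> form the cover, where \<open>r powr (k + 1)\<close> is the first power below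
\<open>\<delta>\<close> up to the constant \<open>D\<close>, which bounds the diameter of the invariant set.
\<close>

lemma gasket_upper:
  "\<exists>C>0. \<forall>\<delta>. 0 < \<delta> \<longrightarrow> \<delta> \<le> 1/2 \<longrightarrow> (\<exists>\<C>. finite \<C> \<and> invariant_set r \<subseteq> \<Union>\<C> \<and>
      (\<forall>U\<in>\<C>. bounded U \<and> diameter U \<le> \<delta>) \<and> real (card \<C>) * \<delta> powr gasket_dim \<le> C)"
proof -
  let ?S = "invariant_set r"
  have "bounded ?S"
    using invariant_set_ratio by (simp add: invariant_def compact_imp_bounded)
  then obtain B where B: "0 < B" "\<And>x. x \<in> ?S \<Longrightarrow> norm x \<le> B"
    by (auto simp: bounded_pos)
  define D where "D = 1 + 2 * B"
  have D: "1 \<le> D"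
    using B by (simp add: D_def)
  obtain K where K: "0 < K" "\<And>n. real (card (cells r n)) * t ^ n \<le> K"
    using cells_le by blast
  have "\<exists>\<C>. finite \<C> \<and> ?S \<subseteq> \<Union>\<C> \<and> (\<forall>U\<in>\<C>. bounded U \<and> diameter U \<le> \<delta>) \<and>
      real (card \<C>) * \<delta> powr gasket_dim \<le> K * D powr gasket_dim / t"
    if \<delta>: "0 < \<delta>" "\<delta> \<le> 1/2" for \<delta>
  proof -
    have "0 < \<delta> / D" "\<delta> / D < 1"
      using \<delta> D by (simp_all add: divide_less_eq)
    then obtain k where k: "r ^ Suc k \<le> \<delta> / D" "\<delta> / D < r ^ k"
      using ex_scale by blast
    define \<C> where "\<C> = (\<lambda>a. place r (Suc k) a ` ?S) ` cells r (Suc k)"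
    have "finite \<C>"
      by (simp add: \<C>_def finite_cells)
    moreover have "?S \<subseteq> \<Union>\<C>"
      unfolding \<C>_def by (rule equalityD1[OF invariant_cells[OF invariant_set_ratio]])
    moreover have "bounded U \<and> diameter U \<le> \<delta>" if U: "U \<in> \<C>" for U
    proof -
      obtain a where a: "U = place r (Suc k) a ` ?S"
        using U unfolding \<C>_def by (elim imageE)
      have "dist x y \<le> \<delta>" if xy: "x \<in> U" "y \<in> U" for x y
      proof -
        obtain x' y' where x': "x' \<in> ?S" "y' \<in> ?S" "x = place r (Suc k) a x'" "y = place r (Suc k) a y'"
          using xy unfolding a by blast
        have "x - y = r ^ Suc k *\<^sub>R (x' - y')"
          by (simp add: x' place_def scaleR_diff_right)
        then have "dist x y = r ^ Suc k * norm (x' - y')"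
          using r_pos by (simp add: dist_norm)
        also have "norm (x' - y') \<le> D"
          using B(2)[OF x'(1)] B(2)[OF x'(2)] norm_triangle_ineq4[of x' y'] by (simp add: D_def)
        then have "r ^ Suc k * norm (x' - y') \<le> r ^ Suc k * D"
          using r_pos by (intro mult_left_mono) auto
        also have "\<dots> \<le> \<delta>"
          using k(1) D by (simp add: pos_le_divide_eq)
        finally show ?thesis .
      qed
      then have "bounded U" "diameter U \<le> \<delta>"
        using \<delta> by (auto simp: bounded_two_points simp flip: dist_norm intro!: diameter_le)
      then show ?thesis ..
    qed
    moreover have "real (card \<C>) * \<delta> powr gasket_dim \<le> K * D powr gasket_dim / t"
    proof -
      have "\<delta> powr gasket_dim \<le> (D * r ^ k) powr gasket_dim"
        using k(2) D \<delta> gasket_dim_pos by (intro powr_mono2) (auto simp: pos_divide_less_eq mult.commute)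
      also have "\<dots> = D powr gasket_dim * t ^ k"
        using D r_pos by (simp add: powr_mult power_powr_gasket_dim)
      finally have "\<delta> powr gasket_dim \<le> D powr gasket_dim * t ^ Suc k / t"
        using t_pos by simp
      moreover have "card \<C> \<le> card (cells r (Suc k))"
        unfolding \<C>_def by (rule card_image_le[OF finite_cells])
      ultimately have "real (card \<C>) * \<delta> powr gasket_dim \<le>
          real (card (cells r (Suc k))) * (D powr gasket_dim * t ^ Suc k / t)"
        by (intro mult_mono) auto
      also have "\<dots> = (real (card (cells r (Suc k))) * t ^ Suc k) * (D powr gasket_dim / t)"
        by simp
      also have "\<dots> \<le> K * (D powr gasket_dim / t)"
        using t_pos by (intro mult_right_mono K(2)) simp
      finally show ?thesis
        by simp
    qed
    ultimately show ?thesis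
      by blast
  qed
  moreover have "0 < K * D powr gasket_dim / t"
    using K(1) D t_pos by simp
  ultimately show ?thesis
    by blast
qed

text \<open>
The error term \<open>e\<close> allows for sets of diameter zero, to which no scale belongs.
\<close>

lemma ex_scale_of_diameter:
  assumes "0 \<le> d" "d < 1" "0 < e"
  shows "\<exists>k. d < r ^ k \<and> t ^ k \<le> d powr gasket_dim / t + e"
proof (cases "d = 0")
  case True
  obtain k where "t ^ k < e"
    using real_arch_pow_inv[OF assms(3) t_less_1] by blast
  then show ?thesis
    using True r_pos by (intro exI[of _ k]) auto
next
  case False
  then obtain k where k: "r ^ Suc k \<le> d" "d < r ^ k"
    using ex_scale[of d] assms by auto
  have "t ^ Suc k \<le> d powr gasket_dim"
    unfolding power_powr_gasket_dim[symmetric]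
    using k(1) r_pos gasket_dim_pos by (intro powr_mono2) auto
  then have "t ^ k \<le> d powr gasket_dim / t"
    using t_pos by (simp add: pos_le_divide_eq mult.commute)
  then show ?thesis
    using k(2) assms(3) by (intro exI[of _ k]) auto
qed

text \<open>
A cell of level \<open>n\<close> lies in a cell of level \<open>k\<close>, and each of these contains at most as many of them as there
are cells of level \<open>n - k\<close>.
\<close>

lemma cells_meeting:
  assumes "z \<in> S" "k \<le> n"
  shows "card {a \<in> cells r n. place r n a z \<in> V} \<le>
    card {b \<in> cells r k. (\<Union>d\<in>cells r (n - k). place r k b ` place r (n - k) d ` S) \<inter> V \<noteq> {}} * card (cells r (n - k))"
    (is "card ?A \<le> card ?B * _")
proof -
  have "?A \<subseteq> (\<lambda>(b, d) c. b c + r ^ k * d c) ` (?B \<times> cells r (n - k))"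
  proof
    fix a assume a: "a \<in> ?A"
    have n: "k + (n - k) = n"
      using assms(2) by simp
    obtain b d where bd: "b \<in> cells r k" "d \<in> cells r (n - k)" "a = (\<lambda>c. b c + r ^ k * d c)"
      using a cells_split[of a r k "n - k"] unfolding n by blast
    have "place r n a z = place r k b (place r (n - k) d z)"
      using place_add[of r k "n - k" b d z] unfolding n bd(3) .
    then have "place r k b (place r (n - k) d z) \<in> V"
      using a by simp
    then have "b \<in> ?B"
      using bd(1,2) assms(1) by blast
    then show "a \<in> (\<lambda>(b, d) c. b c + r ^ k * d c) ` (?B \<times> cells r (n - k))"
      using bd(2,3) by (intro image_eqI[of _ _ "(b, d)"]) auto
  qed
  then have "card ?A \<le> card (?B \<times> cells r (n - k))"
    by (intro surj_card_le) (simp_all add: finite_cells)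
  then show ?thesis
    by (simp add: card_cartesian_product)
qed

text \<open>
The members of a cover are enlarged to open sets of diameter about \<open>r powr k\<^sub>i\<close> and finitely many are
kept.  Distributing the cells of a level finer than all \<open>k\<^sub>i\<close> over them compares \<open>N n\<close> with
\<open>\<Sum>i N (n - k\<^sub>i)\<close>; both are known up to constants.
\<close>

lemma gasket_lower:
  "\<exists>c>0. \<forall>U. delta_cover (1/2) (invariant_set r) U \<longrightarrow> ennreal c \<le> (\<Sum>i. ennreal (diam_pow (U i) gasket_dim))"
proof -
  let ?S = "invariant_set r" and ?s = gasket_dim
  have S: "compact ?S" "?S \<noteq> {}" "bounded ?S"
    using invariant_set_ratio by (auto simp: invariant_def compact_imp_bounded)
  obtain z where z: "z \<in> ?S"
    using S(2) by blast
  have cellS: "(\<Union>d\<in>cells r n. place r n d ` ?S) = ?S" for n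
    using invariant_cells[OF invariant_set_ratio] by simp
  obtain K where K: "0 < K" and neighbours: "\<forall>n V. bounded V \<longrightarrow> diameter V \<le> 3 * r ^ n \<longrightarrow>
      card {a \<in> cells r n. place r n a ` ?S \<inter> V \<noteq> {}} \<le> K"
    using few_neighbours[OF S(3)] by (elim exE conjE)
  obtain C where C: "0 < C" "\<And>n. real (card (cells r n)) * t ^ n \<le> C"
    using cells_le by blast
  define L where "L = real K * C"
  have L: "0 < L"
    using K C(1) by (simp add: L_def)
  have "ennreal (t / (2 * L)) \<le> (\<Sum>i. ennreal (diam_pow (U i) ?s))"
    if U: "delta_cover (1/2) ?S U" for U
  proof -
    have Ub: "bounded (U i)" "diameter (U i) \<le> 1/2" for i
      using U by (auto simp: delta_cover_def)
    \<comment> \<open>The errors sum to at most \<open>1 / (2 L)\<close>, which is half of what the cells demand.\<close>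
    have "\<exists>k. diameter (U i) < r ^ k \<and> t ^ k \<le> diameter (U i) powr ?s / t + 1 / (4 * L) * (1/2) ^ i" for i
      using Ub[of i] L by (intro ex_scale_of_diameter diameter_ge_0) auto
    then obtain k where k: "\<And>i. diameter (U i) < r ^ k i"
        "\<And>i. t ^ k i \<le> diameter (U i) powr ?s / t + 1 / (4 * L) * (1/2) ^ i"
      by metis
    define V where "V i = (\<Union>y\<in>U i. ball y (r ^ k i))" for i
    have UV: "U i \<subseteq> V i" for i
      unfolding V_def using r_pos by auto
    have V: "bounded (V i)" "diameter (V i) \<le> 3 * r ^ k i" for i
    proof -
      have "dist x y \<le> 3 * r ^ k i" if "x \<in> V i" "y \<in> V i" for x y
      proof -
        obtain x' y' where x': "x' \<in> U i" "y' \<in> U i" "dist x' x < r ^ k i" "dist y' y < r ^ k i"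
          using \<open>x \<in> V i\<close> \<open>y \<in> V i\<close> by (auto simp: V_def)
        have "dist x' y' \<le> r ^ k i"
          using diameter_bounded_bound[OF Ub(1) x'(1,2)] k(1)[of i] by simp
        moreover have "dist x y \<le> dist x' x + (dist x' y' + dist y' y)"
          using dist_triangle[of x y x'] dist_triangle[of x' y y'] by (simp add: dist_commute)
        ultimately show ?thesis
          using x'(3,4) by simp
      qed
      then show "bounded (V i)" "diameter (V i) \<le> 3 * r ^ k i"
        using r_pos by (auto simp: bounded_two_points simp flip: dist_norm intro!: diameter_le)
    qed
    have V_open: "open (V i)" for i
      unfolding V_def by blast
    have V_cover: "?S \<subseteq> (\<Union>i. V i)"
      using U UV unfolding delta_cover_def by blast
    obtain I where I: "finite I" "?S \<subseteq> (\<Union>i\<in>I. V i)"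
      by (rule compactE_image[OF S(1) V_open V_cover])
    obtain n where n: "\<And>i. i \<in> I \<Longrightarrow> k i \<le> n"
      using I(1) finite_nat_set_iff_bounded_le[of "k ` I"] by auto
    \<comment> \<open>One point \<open>z\<close> of the invariant set marks each cell, and its image decides which member of the cover accounts for it.\<close>
    define G where "G i = {a \<in> cells r n. place r n a z \<in> V i}" for i
    have "cells r n \<subseteq> (\<Union>i\<in>I. G i)"
    proof
      fix a assume a: "a \<in> cells r n"
      then have "place r n a z \<in> ?S"
        using z cellS[of n] by blast
      then show "a \<in> (\<Union>i\<in>I. G i)"
        using I(2) a by (auto simp: G_def)
    qed
    then have "card (cells r n) \<le> card (\<Union>i\<in>I. G i)"
      using I(1) by (intro card_mono) (auto simp: G_def finite_cells)
    also have "\<dots> \<le> (\<Sum>i\<in>I. card (G i))"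
      using I(1) by (rule card_UN_le)
    finally have "real (card (cells r n)) \<le> (\<Sum>i\<in>I. real (card (G i)))"
      by (simp flip: of_nat_sum)
    then have "real (card (cells r n)) * t ^ n \<le> (\<Sum>i\<in>I. real (card (G i)) * t ^ n)"
      using t_pos by (simp add: mult_right_mono flip: sum_distrib_right)
    also have "\<dots> \<le> (\<Sum>i\<in>I. L * t ^ k i)"
    proof (rule sum_mono)
      fix i assume i: "i \<in> I"
      have "(\<Union>d\<in>cells r (n - k i). place r (k i) b ` place r (n - k i) d ` ?S) = place r (k i) b ` ?S" for b
        by (simp add: cellS flip: image_UN)
      then have "card (G i) \<le> card {b \<in> cells r (k i). place r (k i) b ` ?S \<inter> V i \<noteq> {}} * card (cells r (n - k i))"
        using cells_meeting[OF z n[OF i], of "V i"] by (simp add: G_def)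
      also have "\<dots> \<le> K * card (cells r (n - k i))"
        using V neighbours by (intro mult_right_mono) simp_all
      finally have "real (card (G i)) \<le> real K * real (card (cells r (n - k i)))"
        by (simp flip: of_nat_mult)
      then have "real (card (G i)) * t ^ n \<le> real K * real (card (cells r (n - k i))) * t ^ n"
        using t_pos by (intro mult_right_mono) auto
      also have "t ^ n = t ^ (n - k i) * t ^ k i"
        using n[OF i] by (simp flip: power_add)
      also have "real K * real (card (cells r (n - k i))) * (t ^ (n - k i) * t ^ k i) =
          real K * (real (card (cells r (n - k i))) * t ^ (n - k i)) * t ^ k i"
        by simp
      also have "\<dots> \<le> real K * C * t ^ k i"
        using t_pos C(2) by (intro mult_right_mono mult_left_mono) auto
      finally show "real (card (G i)) * t ^ n \<le> L * t ^ k i"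
        using L_def n[OF i] by (simp flip: power_add)
    qed
    also have "\<dots> \<le> (\<Sum>i\<in>I. L * (diameter (U i) powr ?s / t + 1 / (4 * L) * (1/2) ^ i))"
      using k(2) L by (intro sum_mono mult_left_mono) auto
    also have "\<dots> = L / t * (\<Sum>i\<in>I. diameter (U i) powr ?s) + 1/4 * (\<Sum>i\<in>I. (1/2) ^ i)"
      using L by (simp add: distrib_left sum.distrib sum_distrib_left)
    finally have "1 \<le> L / t * (\<Sum>i\<in>I. diameter (U i) powr ?s) + 1/4 * (\<Sum>i\<in>I. (1/2) ^ i)"
      using cells_ge[of n] by linarith
    moreover have "(\<Sum>i\<in>I. (1/2) ^ i) \<le> (\<Sum>i. (1/2 :: real) ^ i)"
      using I(1) by (intro sum_le_suminf summable_geometric) auto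
    then have "(\<Sum>i\<in>I. (1/2 :: real) ^ i) \<le> 2"
      by (simp add: suminf_geometric)
    ultimately have "1/2 \<le> L / t * (\<Sum>i\<in>I. diameter (U i) powr ?s)"
      by linarith
    then have "t / (2 * L) \<le> (\<Sum>i\<in>I. diameter (U i) powr ?s)"
      using L t_pos by (simp add: field_simps)
    also have "\<dots> = (\<Sum>i\<in>I. diam_pow (U i) ?s)"
      using gasket_dim_pos by (intro sum.cong) (auto simp: diam_pow_def)
    finally have "ennreal (t / (2 * L)) \<le> ennreal (\<Sum>i\<in>I. diam_pow (U i) ?s)"
      by (rule ennreal_leI)
    also have "\<dots> = (\<Sum>i\<in>I. ennreal (diam_pow (U i) ?s))"
      by (rule sum_ennreal[symmetric]) (simp add: diam_pow_def)
    also have "\<dots> \<le> (\<Sum>i. ennreal (diam_pow (U i) ?s))"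
      using I(1) by (intro sum_le_suminf) auto
    finally show ?thesis .
  qed
  then show ?thesis
    using L t_pos by (intro exI[of _ "t / (2 * L)"]) auto
qed

lemma gasket_dimensions:
  "hausdorff_dim (invariant_set r) = ereal (ln t / ln r)"
  "has_box_dim (invariant_set r) (ereal (ln t / ln r))"
proof -
  obtain C where C: "0 < C" and upper: "\<forall>\<delta>. 0 < \<delta> \<longrightarrow> \<delta> \<le> 1/2 \<longrightarrow>
      (\<exists>\<C>. finite \<C> \<and> invariant_set r \<subseteq> \<Union>\<C> \<and>
        (\<forall>U\<in>\<C>. bounded U \<and> diameter U \<le> \<delta>) \<and> real (card \<C>) * \<delta> powr gasket_dim \<le> C)"
    using gasket_upper by (elim exE conjE)
  obtain c where c: "0 < c" and lower: "\<forall>U. delta_cover (1/2) (invariant_set r) U \<longrightarrow>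
      ennreal c \<le> (\<Sum>i. ennreal (diam_pow (U i) gasket_dim))"
    using gasket_lower by (elim exE conjE)
  note dims = dimension_eqI[OF gasket_dim_pos c C upper[rule_format] lower[rule_format]]
  show "hausdorff_dim (invariant_set r) = ereal (ln t / ln r)"
    using dims(1) by (simp only: gasket_dim_def)
  show "has_box_dim (invariant_set r) (ereal (ln t / ln r))"
    using dims(2) by (simp only: gasket_dim_def)
qed

end

section \<open>The parameters\<close>

lemma multinacci_ratio_multinacci:
  assumes "2 \<le> m"
  shows "multinacci_ratio m (multinacci m)"
proof -
  let ?f = "\<lambda>x::real. \<Sum>k=1..m. x ^ k"
  have less: "?f x < ?f y" if "0 < x" "x < y" for x y
    using that assms by (intro sum_strict_mono power_strict_mono) auto
  have at_0: "?f 0 = 0"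
    by (intro sum.neutral) simp
  have "\<exists>x\<ge>0. x \<le> 1 \<and> ?f x = 1"
    using assms at_0 by (intro IVT' continuous_intros) simp_all
  then obtain x where x: "0 \<le> x" "?f x = 1"
    by blast
  then have "0 < x"
    using at_0 by (cases "x = 0") simp_all
  have "\<exists>!x. 0 < x \<and> ?f x = 1"
  proof (rule ex1I[of _ x])
    fix y assume "0 < y \<and> ?f y = 1"
    then show "y = x"
      using less[of x y] less[of y x] x(2) \<open>0 < x\<close> by (cases x y rule: linorder_cases) auto
  qed (use x \<open>0 < x\<close> in auto)
  then have "0 < multinacci m \<and> ?f (multinacci m) = 1"
    unfolding multinacci_def by (rule theI')
  then show ?thesis
    using assms by unfold_locales auto
qed

text \<open>
The polynomial is 1 at 0 and negative at \<open>y = (1 + 1/m) / 3\<close>, because \<open>3 m < 2\<^sup>m\<^sup>+\<^sup>1\<close>.  Its zeros in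
the interval form a compact set, so a least positive root exists and lies below \<open>y\<close>.
\<close>

lemma tau_properties:
  assumes "2 \<le> m"
  shows "0 < tau m" "3 * tau m ^ (m + 1) - 3 * tau m + 1 = 0" "real m * (3 * tau m - 1) < 1"
proof -
  let ?p = "\<lambda>z::real. 3 * z ^ (m + 1) - 3 * z + 1"
  define y where "y = 1/3 + 1 / (3 * real m)"
  have y: "0 < y" "y \<le> 1/2"
    using assms by (simp_all add: y_def field_simps)
  have "3 * m < 2 ^ (m + 1)"
    using assms by (induction m rule: dec_induct) auto
  then have "3 * real m < 2 ^ (m + 1)"
    by (metis of_nat_less_iff of_nat_mult of_nat_numeral of_nat_power)
  have "3 * y ^ (m + 1) \<le> 3 * (1/2) ^ (m + 1)"
    using y by (intro mult_left_mono power_mono) auto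
  also have "\<dots> < 1 / real m"
    using \<open>3 * real m < 2 ^ (m + 1)\<close> assms by (simp add: power_divide field_simps)
  also have "1 / real m = 3 * y - 1"
    by (simp add: y_def)
  finally have py: "?p y < 0"
    by simp
  define Z where "Z = {0..y} \<inter> {z. ?p z = 0}"
  have "closed {z. ?p z = 0}"
    by (intro closed_Collect_eq continuous_intros)
  then have "compact Z"
    unfolding Z_def by (intro compact_Int_closed) auto
  moreover have "Z \<noteq> {}"
  proof -
    have "\<exists>x\<ge>0. x \<le> y \<and> ?p x = 0"
      using py y by (intro IVT2' continuous_intros) simp_all
    then show ?thesis
      by (auto simp: Z_def)
  qed
  ultimately have "\<exists>z\<in>Z. \<forall>w\<in>Z. z \<le> w"
    by (rule compact_attains_inf)
  then obtain z where z: "z \<in> Z" "\<And>w. w \<in> Z \<Longrightarrow> z \<le> w"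
    by blast
  have root: "0 < z" "?p z = 0" "z \<le> y"
    using z(1) by (auto simp: Z_def less_le)
  have "tau m = z"
    unfolding tau_def
  proof (rule Least_equality)
    fix w assume "0 < w \<and> ?p w = 0"
    then show "z \<le> w"
      using z(2)[of w] root(3) by (cases "w \<le> y") (auto simp: Z_def)
  qed (use root in auto)
  moreover have "z < y"
    using root py by (cases "z = y") auto
  then have "real m * (3 * z - 1) < 1"
    using assms by (simp add: y_def field_simps)
  ultimately show "0 < tau m" "?p (tau m) = 0" "real m * (3 * tau m - 1) < 1"
    using root by auto
qed

theorem theorem4p4:
  fixes m :: nat
  assumes "m \<ge> 2"
  shows "hausdorff_dim (invariant_set (multinacci m)) = ereal (ln (tau m) / ln (multinacci m)) \<and>
         has_box_dim (invariant_set (multinacci m)) (ereal (ln (tau m) / ln (multinacci m))) \<and>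
         0 < tau m \<and> tau m < 1/2"
proof -
  note tau = tau_properties[OF assms]
  interpret multinacci_ratio m "multinacci m"
    using assms by (rule multinacci_ratio_multinacci)
  interpret multinacci_gasket m "multinacci m" "tau m"
    using tau by unfold_locales
  have "2 * (3 * tau m - 1) \<le> real m * (3 * tau m - 1)"
    using assms t_excess_pos by (intro mult_right_mono) auto
  then have "2 * (3 * tau m - 1) < 1"
    using tau(3) by (rule le_less_trans)
  then have "tau m < 1/2"
    by simp
  then show ?thesis
    using gasket_dimensions tau(1) by blast
qed

end
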